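(* Let $A_1,\ldots,A_6\in\mathbb{P}^2$ be the vertices of a hexagon $\mathcal{H}$ in the complex projective plane, and let $\mathcal{A}=\mathcal{A}(A_1,\ldots,A_6): f=0$ be the associated hexagonal line arrangement. Assume that $A_1,\ldots,A_6$ are not situated on a conic, and that $\mathcal{A}$ consists of 9 distinct lines and has only double points except for 6 triple points, situated at $A_1,\ldots,A_6$. Then $I_8=J_8$, $\mathrm{mdr}(f)=6$ and $\mathcal{A}$ is 2-formal.
   Context: $S=\mathbb{C}[x,y,z]$ with its standard grading; $S_k$ is the space of homogeneous polynomials of degree $k$, and for a homogeneous ideal $K\subset S$, $K_k=K\cap S_k$. Hexagonal arrangement: given points $A_1,\ldots,A_6\in\mathbb{P}^2=\mathbb{P}^2(\mathbb{C})$, with $A_7=A_1$, the sides of the hexagon $\mathcal{H}$ are the lines $L_j:\ell_j=0$ determined by $A_j$ and $A_{j+1}$, $j=1,\ldots,6$, and the diagonals are the lines $L_k':\ell_k'=0$ determined by $A_k$ and $A_{k+3}$, $k=1,2,3$; here $\ell_j,\ell_k'\in S_1$ are linear forms. Set $\mathcal{A}(A_1,\ldots,A_6)=L_1\cup\cdots\cup L_6\cup L_1'\cup L_2'\cup L_3'$, with defining equation $f=\ell_1\cdots\ell_6\,\ell_1'\ell_2'\ell_3'=0$ of degree 9. A double (resp. triple) point of the arrangement is a point lying on exactly two (resp. three) of its lines. A conic is the zero set of a nonzero quadratic form in $S_2$ (possibly degenerate). $J=J_f=(f_x,f_y,f_z)\subset S$ is the Jacobian ideal of $f$, generated by the partial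 derivatives of $f$, and $I=I_f$ is the saturation of $J$ with respect to the maximal ideal $(x,y,z)$. Minimal degree of a Jacobian relation: $D_0(f)=\{(a,b,c)\in S^3: af_x+bf_y+cf_z=0\}$ is the graded $S$-module of Jacobian syzygies of $f$, where a syzygy has degree $k$ if $a,b,c\in S_k$; $\mathrm{mdr}(f)$ is the smallest degree of a nonzero homogeneous element of $D_0(f)$. 2-formality: for an arrangement of $d$ distinct lines with equations given by linear forms $m_1,\ldots,m_d\in S_1$, the relation space $F(\mathcal{A})$ is the kernel of the linear map $\mathbb{C}^d\to S_1$, $e_j\mapsto m_j$, where $e_1,\ldots,e_d$ is the canonical basis of $\mathbb{C}^d$. The arrangement is 2-formal if $F(\mathcal{A})$ is spanned by relations involving only 3 lines of $\mathcal{A}$ (i.e. by vectors of $F(\mathcal{A})$ with exactly three nonzero coordinates). *)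

theory Defs
  imports "HOL-Analysis.Analysis" "HOL-Library.Poly_Mapping"
begin

section \<open>The polynomial ring \<open>S = \<complex>[x,y,z]\<close>\<close>

text \<open>
  Polynomials are finitely supported maps from exponent vectors to coefficients, with the
  convolution product of \<^theory>\<open>HOL-Library.Poly_Mapping\<close>. The three variables
  are indexed by the type \<^typ>\<open>3\<close>.
\<close>

type_synonym poly3 = "(3 \<Rightarrow>\<^sub>0 nat) \<Rightarrow>\<^sub>0 complex"

definition var :: "3 \<Rightarrow> poly3" where
  "var i = Poly_Mapping.single (Poly_Mapping.single i 1) 1"

definition const :: "complex \<Rightarrow> poly3" where
  "const c = Poly_Mapping.single 0 c"

definition mon_degree :: "(3 \<Rightarrow>\<^sub>0 nat) \<Rightarrow> nat" where
  "mon_degree m = (\<Sum>i\<in>UNIV. Poly_Mapping.lookup m i)"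

definition eval :: "poly3 \<Rightarrow> complex^3 \<Rightarrow> complex" where
  "eval p v = (\<Sum>m\<in>Poly_Mapping.keys p.
     Poly_Mapping.lookup p m * (\<Prod>i\<in>UNIV. (v $ i) ^ Poly_Mapping.lookup m i))"

text \<open>
  Subtraction of exponents is truncated, but the monomials in which it truncates have
  coefficient \<open>0\<close> in the partial derivative.
\<close>

definition partial :: "3 \<Rightarrow> poly3 \<Rightarrow> poly3" where
  "partial i p = (\<Sum>m\<in>Poly_Mapping.keys p.
     Poly_Mapping.single (m - Poly_Mapping.single i 1)
       (of_nat (Poly_Mapping.lookup m i) * Poly_Mapping.lookup p m))"

text \<open>The graded piece \<open>S\<^sub>k\<close>; it contains \<open>0\<close>.\<close>

definition homog :: "nat \<Rightarrow> poly3 set" where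
  "homog k = {p. \<forall>m\<in>Poly_Mapping.keys p. mon_degree m = k}"

section \<open>Ideals of \<open>S\<close>\<close>

definition ideal_gen :: "poly3 set \<Rightarrow> poly3 set" where
  "ideal_gen B = module.span (*) B"

fun ideal_power :: "poly3 set \<Rightarrow> nat \<Rightarrow> poly3 set" where
  "ideal_power K 0 = UNIV"
| "ideal_power K (Suc n) = ideal_gen {a * b | a b. a \<in> K \<and> b \<in> ideal_power K n}"

text \<open>\<open>saturation J K\<close> is the union over \<open>n\<close> of the ideal quotients \<open>J : K\<^sup>n\<close>.\<close>

definition saturation :: "poly3 set \<Rightarrow> poly3 set \<Rightarrow> poly3 set" where
  "saturation J K = {p. \<exists>n. \<forall>q\<in>ideal_power K n. q * p \<in> J}"

definition max_ideal :: "poly3 set" where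
  "max_ideal = ideal_gen (range var)"

definition jacobian_ideal :: "poly3 \<Rightarrow> poly3 set" where
  "jacobian_ideal f = ideal_gen (range (\<lambda>i. partial i f))"

definition saturated_jacobian_ideal :: "poly3 \<Rightarrow> poly3 set" where
  "saturated_jacobian_ideal f = saturation (jacobian_ideal f) max_ideal"

section \<open>Jacobian syzygies\<close>

definition jacobian_syzygies :: "poly3 \<Rightarrow> (poly3^3) set" where
  "jacobian_syzygies f = {r. (\<Sum>i\<in>UNIV. r $ i * partial i f) = 0}"

text \<open>
  The set of degrees is never empty for homogeneous \<open>f\<close>: it contains the degree of a
  Koszul relation, or \<open>0\<close> if all partial derivatives vanish.
\<close>

definition mdr :: "poly3 \<Rightarrow> nat" where
  "mdr f = (LEAST k. \<exists>r\<in>jacobian_syzygies f. r \<noteq> 0 \<and> (\<forall>i. r $ i \<in> homog k))"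

section \<open>The complex projective plane\<close>

definition proportional :: "complex^3 \<Rightarrow> complex^3 \<Rightarrow> bool" where
  "proportional u v \<longleftrightarrow> u \<noteq> 0 \<and> v \<noteq> 0 \<and> (\<exists>c. c \<noteq> 0 \<and> v = c *s u)"

lemma part_equivp_proportional: "part_equivp proportional"
proof (rule part_equivpI)
  show "\<exists>v. proportional v v"
    by (rule exI[of _ "\<chi> i. 1"]) (auto simp: proportional_def vec_eq_iff intro!: exI[of _ 1])
  show "symp proportional"
  proof (rule sympI)
    fix u v assume "proportional u v"
    then obtain c where c: "u \<noteq> 0" "v \<noteq> 0" "c \<noteq> 0" "v = c *s u"
      by (auto simp: proportional_def)
    then have "u = inverse c *s v" by (simp add: vector_smult_assoc)
    with c show "proportional v u"
      unfolding proportional_def by (meson nonzero_imp_inverse_nonzero)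
  qed
  show "transp proportional"
  proof (rule transpI)
    fix u v w assume "proportional u v" "proportional v w"
    then obtain c d where "u \<noteq> 0" "w \<noteq> 0" "c \<noteq> 0" "d \<noteq> 0" "w = (d * c) *s u"
      by (auto simp: proportional_def vector_smult_assoc)
    then show "proportional u w"
      unfolding proportional_def by (metis mult_eq_0_iff)
  qed
qed

text \<open>
  \<open>point v\<close> is the point with homogeneous coordinates \<open>v\<close>; it is meaningful only
  for \<open>v \<noteq> 0\<close>.
\<close>

quotient_type proj_plane = "complex^3" / partial: proportional
  morphisms coords point
  by (rule part_equivp_proportional)

text \<open>The zero set in the projective plane of a homogeneous polynomial.\<close>

definition zero_set :: "poly3 \<Rightarrow> proj_plane set" where
  "zero_set p = {P. \<forall>v. v \<noteq> 0 \<and> point v = P \<longrightarrow> eval p v = 0}"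

definition is_conic :: "proj_plane set \<Rightarrow> bool" where
  "is_conic C \<longleftrightarrow> (\<exists>q\<in>homog 2. q \<noteq> 0 \<and> C = zero_set q)"

section \<open>Line arrangements\<close>

text \<open>
  Arrangements are given by lists of linear forms; \<open>lines ms\<close> is the set of the
  corresponding lines, so a repeated line is counted only once in it.
\<close>

definition lines :: "poly3 list \<Rightarrow> proj_plane set set" where
  "lines ms = zero_set ` set ms"

definition multiplicity_at :: "proj_plane set set \<Rightarrow> proj_plane \<Rightarrow> nat" where
  "multiplicity_at \<A> P = card {L \<in> \<A>. P \<in> L}"

definition double_points :: "proj_plane set set \<Rightarrow> proj_plane set" where
  "double_points \<A> = {P. multiplicity_at \<A> P = 2}"

definition triple_points :: "proj_plane set set \<Rightarrow> proj_plane set" where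
  "triple_points \<A> = {P. multiplicity_at \<A> P = 3}"

definition multiple_points :: "proj_plane set set \<Rightarrow> proj_plane set" where
  "multiple_points \<A> = {P. multiplicity_at \<A> P \<ge> 2}"

text \<open>
  The space \<open>\<complex>\<^sup>d\<close>, for \<open>d\<close> the number of linear forms, is rendered as the
  space of finitely supported sequences with support in \<open>{..<d}\<close>.
\<close>

definition relation_space :: "poly3 list \<Rightarrow> (nat \<Rightarrow>\<^sub>0 complex) set" where
  "relation_space ms = {c. Poly_Mapping.keys c \<subseteq> {..<length ms} \<and>
     (\<Sum>j<length ms. const (Poly_Mapping.lookup c j) * ms ! j) = 0}"

definition two_formal :: "poly3 list \<Rightarrow> bool" where
  "two_formal ms \<longleftrightarrow>
     module.span (\<lambda>a. Poly_Mapping.map ((*) a))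
       {c \<in> relation_space ms. card (Poly_Mapping.keys c) = 3} = relation_space ms"

section \<open>Hexagonal arrangements\<close>

definition equation_of_join :: "poly3 \<Rightarrow> proj_plane \<Rightarrow> proj_plane \<Rightarrow> bool" where
  "equation_of_join m P Q \<longleftrightarrow>
     P \<noteq> Q \<and> m \<in> homog 1 \<and> m \<noteq> 0 \<and> P \<in> zero_set m \<and> Q \<in> zero_set m"

text \<open>
  The vertices are \<open>A 1, \<dots>, A 6\<close>, the sides have equations \<open>l 1, \<dots>, l 6\<close> and the
  diagonals have equations \<open>l' 1, l' 2, l' 3\<close>; all other values are irrelevant, except
  for the convention \<open>A 7 = A 1\<close>.
\<close>

definition hexagon_equations ::
    "(nat \<Rightarrow> proj_plane) \<Rightarrow> (nat \<Rightarrow> poly3) \<Rightarrow> (nat \<Rightarrow> poly3) \<Rightarrow> bool" where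
  "hexagon_equations A l l' \<longleftrightarrow> A 7 = A 1 \<and>
     (\<forall>j\<in>{1..6}. equation_of_join (l j) (A j) (A (j + 1))) \<and>
     (\<forall>k\<in>{1..3}. equation_of_join (l' k) (A k) (A (k + 3)))"

definition hexagon_forms :: "(nat \<Rightarrow> poly3) \<Rightarrow> (nat \<Rightarrow> poly3) \<Rightarrow> poly3 list" where
  "hexagon_forms l l' = map l [1..<7] @ map l' [1..<4]"

end

theory Submission
  imports Defs
begin

text \<open>
  Put \<open>P\<^sub>1, P\<^sub>2, P\<^sub>3 = A\<^sub>1, A\<^sub>3, A\<^sub>5\<close> and \<open>Q\<^sub>1, Q\<^sub>2, Q\<^sub>3 = A\<^sub>2, A\<^sub>4, A\<^sub>6\<close>. Sides and long diagonals
  together are the nine joins \<open>P\<^sub>iQ\<^sub>j\<close>, the edges of a complete bipartite graph. Write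
  \<open>[u v w]\<close> for the determinant of three vectors. If

    \<open>[P\<^sub>3Q\<^sub>2P\<^sub>1] [Q\<^sub>3Q\<^sub>1P\<^sub>1] [P\<^sub>3Q\<^sub>1P\<^sub>2] [Q\<^sub>3Q\<^sub>2P\<^sub>2] = [P\<^sub>3Q\<^sub>1P\<^sub>1] [Q\<^sub>3Q\<^sub>2P\<^sub>1] [P\<^sub>3Q\<^sub>2P\<^sub>2] [Q\<^sub>3Q\<^sub>1P\<^sub>2]\<close>

  then the member through \<open>P\<^sub>1\<close> of the pencil of conics through \<open>P\<^sub>3, Q\<^sub>1, Q\<^sub>2, Q\<^sub>3\<close> also
  passes through \<open>P\<^sub>2\<close> (\<open>conic_through_six\<close>). So the hypothesis on conics implies that the
  two sides differ, and from this one inequality come 2-formality, the equality \<open>I\<^sub>8 = J\<^sub>8\<close> and the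
  absence of syzygies of degree less than 6.

  2-formality. The three lines through a vertex satisfy one linear relation. To write a given
  relation as a combination of these six, match its coefficients on the four edges between
  \<open>P\<^sub>1, P\<^sub>2\<close> and \<open>Q\<^sub>1, Q\<^sub>2\<close>; this is a linear system for the multipliers at these four
  vertices, and its determinant is, up to a nonzero factor, the difference of the two sides
  above. The multipliers at \<open>P\<^sub>3\<close> and \<open>Q\<^sub>3\<close> remove two more edges, and the remaining three forms
  are independent (\<open>relations_spanned_by_vertices\<close>). Dually, a family of nine numbers \<open>c\<^sub>i\<^sub>j\<close>
  that at each vertex agrees with the values \<open>\<ell>\<^sub>i\<^sub>j(w)\<close> at some vector \<open>w\<close> agrees with such values
  for one single \<open>w\<close> (\<open>values_given_at_vertices\<close>).

  \<open>I\<^sub>8 = J\<^sub>8\<close>. Let \<open>m\<^sup>n g = \<theta>(f)\<close> for a linear form \<open>m\<close> and a polynomial vector field \<open>\<theta>\<close>. On the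
  line \<open>\<ell> = 0\<close> one has \<open>\<theta>(f) = \<theta>(\<ell>) f/\<ell>\<close>. Choosing \<open>m\<close> constant along an affine chart of
  that line shows that \<open>g\<close> is a constant multiple \<open>c \<cdot> f/\<ell>\<close> there, both having degree 8.
  Choosing \<open>m = 1\<close> at a vertex \<open>V\<close> shows \<open>c = \<ell>(\<theta>(V))\<close> for the three lines through \<open>V\<close>. Hence
  \<open>c = \<ell>(w)\<close> on all nine lines for some \<open>w\<close>, so \<open>g\<close> and the derivative of \<open>f\<close> in direction \<open>w\<close>
  agree on nine lines; having degree 8, they are equal (\<open>saturated_degree_8\<close>).

  \<open>mdr f = 6\<close>. Let \<open>h\<close> be the product of the six lines that miss the vertex \<open>v = P\<^sub>1\<close>; correcting
  the field \<open>h \<partial>\<^sub>v\<close> by a multiple of the Euler field gives a syzygy of degree 6. Conversely a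
  syzygy of degree below 6 has a multiple \<open>\<theta>\<close> of degree 5. It is tangent to all nine lines, so \<open>\<omega>(v) = \<theta>(v) \<times> v\<close>, of
  degree 6, is along each line a multiple of its normal vector. It vanishes at the six multiple
  points of that line, so it is determined there by one number \<open>c\<^sub>i\<^sub>j\<close>. At a vertex the
  linear part of \<open>\<theta>\<close> has three eigendirections in the two-dimensional tangent plane, hence is a
  scalar; this links the \<open>c\<^sub>i\<^sub>j\<close> of the three lines there. If one \<open>c\<^sub>i\<^sub>j\<close> is nonzero then
  all are, and comparing the links at \<open>P\<^sub>1, P\<^sub>2, Q\<^sub>1, Q\<^sub>2\<close> yields the displayed equation. So
  \<open>\<omega> = 0\<close> on nine lines, hence everywhere, \<open>\<theta>\<close> is a multiple of the Euler field, and a syzygy of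
  that kind is zero (\<open>no_tangent_field\<close>, \<open>no_syzygy_degree_5\<close>).
\<close>

section \<open>Evaluation of polynomials\<close>

definition mono_eval :: "(3 \<Rightarrow>\<^sub>0 nat) \<Rightarrow> complex^3 \<Rightarrow> complex" where
  "mono_eval m v = (\<Prod>i\<in>UNIV. (v $ i) ^ Poly_Mapping.lookup m i)"

lemma eval_eq_sum:
  assumes "finite S" "Poly_Mapping.keys p \<subseteq> S"
  shows "eval p v = (\<Sum>m\<in>S. Poly_Mapping.lookup p m * mono_eval m v)"
  unfolding eval_def mono_eval_def
  by (rule sum.mono_neutral_left) (use assms in \<open>auto simp: in_keys_iff\<close>)

lemma eval_zero [simp]: "eval 0 v = 0"
  by (simp add: eval_def)

lemma eval_add [simp]: "eval (p + q) v = eval p v + eval q v"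
proof -
  let ?S = "Poly_Mapping.keys p \<union> Poly_Mapping.keys q"
  show ?thesis
    using eval_eq_sum[of ?S p v] eval_eq_sum[of ?S q v]
      eval_eq_sum[of ?S "p + q" v] Poly_Mapping.keys_add[of p q]
    by (simp add: lookup_add distrib_right sum.distrib)
qed

lemma eval_uminus [simp]: "eval (- p) v = - eval p v"
  using eval_add[of p "- p" v] by (simp add: eq_neg_iff_add_eq_0 add.commute)

lemma eval_diff [simp]: "eval (p - q) v = eval p v - eval q v"
  using eval_add[of p "- q" v] by simp

lemma eval_sum: "eval (\<Sum>x\<in>A. F x) v = (\<Sum>x\<in>A. eval (F x) v)"
  by (induction A rule: infinite_finite_induct) auto

lemma eval_single: "eval (Poly_Mapping.single m c) v = c * mono_eval m v"
  using eval_eq_sum[of "{m}" "Poly_Mapping.single m c" v] by simp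

lemma eval_const [simp]: "eval (const c) v = c"
  by (simp add: const_def eval_single mono_eval_def)

lemma eval_one [simp]: "eval 1 v = 1"
  using eval_const[of 1 v] by (simp add: const_def)

lemma eval_var [simp]: "eval (var i) v = v $ i"
proof -
  have "(\<Prod>j\<in>UNIV. (v $ j) ^ Poly_Mapping.lookup (Poly_Mapping.single i (Suc 0)) j)
      = (\<Prod>j\<in>UNIV. if j = i then v $ i else 1)"
    by (rule prod.cong) (auto simp: lookup_single)
  then show ?thesis by (simp add: var_def eval_single mono_eval_def)
qed

lemma mono_eval_add: "mono_eval (m + n) v = mono_eval m v * mono_eval n v"
  by (simp add: mono_eval_def lookup_add power_add prod.distrib)

lemma poly3_eq_sum_singles:
  "p = (\<Sum>m\<in>Poly_Mapping.keys p. Poly_Mapping.single m (Poly_Mapping.lookup p m))"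
  by (rule poly_mapping_eqI)
    (auto simp: lookup_sum lookup_single when_def in_keys_iff)

lemma eval_mult [simp]: "eval (p * q) v = eval p v * eval q v"
proof -
  let ?P = "Poly_Mapping.keys p" and ?Q = "Poly_Mapping.keys q"
  have "p * q = (\<Sum>m\<in>?P. \<Sum>n\<in>?Q. Poly_Mapping.single m (Poly_Mapping.lookup p m)
      * Poly_Mapping.single n (Poly_Mapping.lookup q n))"
    by (subst poly3_eq_sum_singles[of p], subst poly3_eq_sum_singles[of q])
      (simp add: sum_product)
  then have "eval (p * q) v = (\<Sum>m\<in>?P. \<Sum>n\<in>?Q.
      (Poly_Mapping.lookup p m * mono_eval m v) * (Poly_Mapping.lookup q n * mono_eval n v))"
    by (simp add: eval_sum mult_single eval_single mono_eval_add mult_ac)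
  also have "\<dots> = eval p v * eval q v"
    by (simp add: eval_eq_sum[of ?P p] eval_eq_sum[of ?Q q] sum_product)
  finally show ?thesis .
qed

lemma eval_power [simp]: "eval (p ^ n) v = eval p v ^ n"
  by (induction n) auto

lemma eval_prod: "eval (\<Prod>x\<in>A. F x) v = (\<Prod>x\<in>A. eval (F x) v)"
  by (induction A rule: infinite_finite_induct) auto

text \<open>
  Kronecker's substitution: along the curve \<open>(t, t\<^sup>N, t\<^sup>N\<^sup>*\<^sup>N)\<close>, with \<open>N\<close> larger than all exponents,
  distinct monomials become distinct powers of \<open>t\<close>, since their exponents are read off as digits
  in base \<open>N\<close>.
\<close>
lemma poly3_eqI:
  assumes "\<And>v. eval p v = eval q v"
  shows "p = q"
proof -
  have "d = 0" if ev: "\<And>v. eval d v = 0" for d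
  proof (rule ccontr)
    assume "d \<noteq> 0"
    let ?K = "Poly_Mapping.keys d"
    define N where "N = Suc (\<Sum>m\<in>?K. \<Sum>i\<in>UNIV. Poly_Mapping.lookup m i)"
    have small: "Poly_Mapping.lookup m i < N" if "m \<in> ?K" for m i
    proof -
      have "Poly_Mapping.lookup m i \<le> (\<Sum>i\<in>UNIV. Poly_Mapping.lookup m i)"
        by (rule member_le_sum) auto
      also have "\<dots> \<le> (\<Sum>m\<in>?K. \<Sum>i\<in>UNIV. Poly_Mapping.lookup m i)"
        by (rule member_le_sum) (use that in auto)
      finally show ?thesis by (simp add: N_def)
    qed
    have N0: "N \<noteq> 0" by (simp add: N_def)
    define \<phi> where "\<phi> m = Poly_Mapping.lookup m (1::3)
      + N * (Poly_Mapping.lookup m 2 + N * Poly_Mapping.lookup m 3)" for m :: "3 \<Rightarrow>\<^sub>0 nat"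
    have inj: "inj_on \<phi> ?K"
    proof (rule inj_onI)
      fix m n assume mn: "m \<in> ?K" "n \<in> ?K" "\<phi> m = \<phi> n"
      have digits: "Poly_Mapping.lookup k 1 = \<phi> k mod N
          \<and> Poly_Mapping.lookup k 2 = \<phi> k div N mod N \<and> Poly_Mapping.lookup k 3 = \<phi> k div N div N"
        if "k \<in> ?K" for k
      proof -
        have "\<phi> k div N = Poly_Mapping.lookup k 2 + N * Poly_Mapping.lookup k 3"
          using small[OF that, of 1] N0 unfolding \<phi>_def by (subst div_mult_self2) auto
        moreover have "(Poly_Mapping.lookup k 2 + N * Poly_Mapping.lookup k 3) div N
            = Poly_Mapping.lookup k 3"
          using small[OF that, of 2] N0 by (subst div_mult_self2) auto
        moreover have "(Poly_Mapping.lookup k 2 + N * Poly_Mapping.lookup k 3) mod N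
            = Poly_Mapping.lookup k 2"
          using small[OF that, of 2] by (subst mod_mult_self2) auto
        moreover have "\<phi> k mod N = Poly_Mapping.lookup k 1"
          using small[OF that, of 1] unfolding \<phi>_def by (subst mod_mult_self2) auto
        ultimately show ?thesis by simp
      qed
      note a = digits[OF mn(1)] digits[OF mn(2)]
      have "\<forall>i. Poly_Mapping.lookup m i = Poly_Mapping.lookup n i"
        unfolding forall_3 using a mn(3) by simp
      then show "m = n" by (intro poly_mapping_eqI) auto
    qed
    define u where "u = (\<Sum>m\<in>?K. monom (Poly_Mapping.lookup d m) (\<phi> m))"
    have mono: "t ^ \<phi> m = mono_eval m (vector [t, t ^ N, t ^ (N * N)])" for t :: complex and m
      unfolding mono_eval_def \<phi>_def UNIV_3
      by (simp add: power_add distrib_left power_mult)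
    have "poly u t = eval d (vector [t, t ^ N, t ^ (N * N)])" for t
      unfolding u_def eval_eq_sum[OF finite_keys subset_refl]
      by (simp add: poly_sum poly_monom mono)
    then have u0: "u = 0"
      using ev poly_all_0_iff_0[of u] by simp
    have "?K \<noteq> {}"
      using poly3_eq_sum_singles[of d] \<open>d \<noteq> 0\<close> by (metis sum.empty)
    then obtain m where m: "m \<in> ?K" by blast
    have "coeff u (\<phi> m) = (\<Sum>n\<in>?K. if n = m then Poly_Mapping.lookup d m else 0)"
      unfolding u_def coeff_sum coeff_monom
      by (rule sum.cong) (use inj m in \<open>auto simp: inj_on_def\<close>)
    also have "\<dots> = Poly_Mapping.lookup d m" using m by simp
    finally show False using u0 m by (simp add: in_keys_iff)
  qed
  from this[of "p - q"] assms show ?thesis by simp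
qed

section \<open>Homogeneous polynomials\<close>

lemma mon_degree_zero [simp]: "mon_degree 0 = 0"
  by (simp add: mon_degree_def)

lemma mon_degree_add: "mon_degree (m + n) = mon_degree m + mon_degree n"
  by (simp add: mon_degree_def lookup_add sum.distrib)

lemma mon_degree_single [simp]: "mon_degree (Poly_Mapping.single i k) = k"
  by (simp add: mon_degree_def lookup_single when_def)

lemma homog_single: "mon_degree m = k \<Longrightarrow> Poly_Mapping.single m c \<in> homog k"
  by (auto simp: homog_def split: if_splits)

lemma homog_zero [intro, simp]: "0 \<in> homog k"
  by (simp add: homog_def)

lemma homog_const [intro, simp]: "const c \<in> homog 0"
  by (simp add: const_def homog_single)

lemma homog_one [intro, simp]: "1 \<in> homog 0"
  using homog_const[of 1] by (simp add: const_def)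

lemma homog_var [intro, simp]: "var i \<in> homog 1"
  by (simp add: var_def homog_single)

lemma homog_add [intro]: "p \<in> homog k \<Longrightarrow> q \<in> homog k \<Longrightarrow> p + q \<in> homog k"
  using Poly_Mapping.keys_add[of p q] by (auto simp: homog_def)

lemma homog_uminus [intro]: "p \<in> homog k \<Longrightarrow> - p \<in> homog k"
  by (auto simp: homog_def in_keys_iff)

lemma homog_diff [intro]: "p \<in> homog k \<Longrightarrow> q \<in> homog k \<Longrightarrow> p - q \<in> homog k"
  using homog_add[of p k "- q"] by auto

lemma homog_sum [intro]: "(\<And>x. x \<in> A \<Longrightarrow> F x \<in> homog k) \<Longrightarrow> (\<Sum>x\<in>A. F x) \<in> homog k"
  by (induction A rule: infinite_finite_induct) auto

lemma homog_mult [intro]: "p \<in> homog j \<Longrightarrow> q \<in> homog k \<Longrightarrow> p * q \<in> homog (j + k)"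
  using Poly_Mapping.keys_mult[of p q] by (fastforce simp: homog_def mon_degree_add)

lemma homog_const_mult [intro]: "p \<in> homog k \<Longrightarrow> const c * p \<in> homog k"
  using homog_mult[of "const c" 0 p k] by simp

lemma homog_prod:
  "(\<And>x. x \<in> A \<Longrightarrow> F x \<in> homog 1) \<Longrightarrow> (\<Prod>x\<in>A. F x) \<in> homog (card A)"
proof (induction A rule: infinite_finite_induct)
  case (insert x A)
  then show ?case using homog_mult[of "F x" 1 "prod F A" "card A"] by simp
qed auto

lemma mono_eval_scale: "mono_eval m (c *s v) = c ^ mon_degree m * mono_eval m v"
  by (simp add: mono_eval_def mon_degree_def power_mult_distrib prod.distrib power_sum)

lemma eval_scale: "p \<in> homog k \<Longrightarrow> eval p (c *s v) = c ^ k * eval p v"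
  unfolding eval_eq_sum[OF finite_keys subset_refl]
  by (auto simp: homog_def mono_eval_scale sum_distrib_left intro!: sum.cong)

lemma eval_homog_0: "p \<in> homog 0 \<Longrightarrow> eval p v = eval p w"
  using eval_scale[of p 0 0 v] eval_scale[of p 0 0 w] by simp

section \<open>Partial derivatives\<close>

text \<open>
  The derivative of \<open>p\<close> at \<open>v\<close> in direction \<open>w\<close>. It is identified with the derivative of
  \<open>t \<mapsto> p (v + t w)\<close> below; with \<open>poly3_eqI\<close>, that reduces the rules for formal partial
  derivatives to calculus in one variable.
\<close>
definition dir_deriv :: "poly3 \<Rightarrow> complex^3 \<Rightarrow> complex^3 \<Rightarrow> complex" where
  "dir_deriv p v w = (\<Sum>k\<in>UNIV. w $ k * eval (partial k p) v)"

lemma eval_partial: "eval (partial k p) v = (\<Sum>m\<in>Poly_Mapping.keys p.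
   of_nat (Poly_Mapping.lookup m k) * Poly_Mapping.lookup p m
     * mono_eval (m - Poly_Mapping.single k 1) v)"
  by (simp add: partial_def eval_sum eval_single)

lemma homog_partial: "p \<in> homog (Suc d) \<Longrightarrow> partial k p \<in> homog d"
  unfolding partial_def
proof (rule homog_sum)
  fix m assume p: "p \<in> homog (Suc d)" and m: "m \<in> Poly_Mapping.keys p"
  show "Poly_Mapping.single (m - Poly_Mapping.single k 1)
         (of_nat (Poly_Mapping.lookup m k) * Poly_Mapping.lookup p m) \<in> homog d"
  proof (cases "Poly_Mapping.lookup m k = 0")
    case False
    have "m = (m - Poly_Mapping.single k 1) + Poly_Mapping.single k 1"
      using False by (intro poly_mapping_eqI) (auto simp: lookup_add lookup_minus lookup_single when_def)
    then have "mon_degree m = Suc (mon_degree (m - Poly_Mapping.single k 1))"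
      by (metis Suc_eq_plus1 mon_degree_add mon_degree_single)
    then show ?thesis using p m by (intro homog_single) (auto simp: homog_def)
  qed simp
qed

lemma mono_eval_deriv:
  "((\<lambda>t. mono_eval m (v + t *s w)) has_field_derivative
    (\<Sum>k\<in>UNIV. w $ k * (of_nat (Poly_Mapping.lookup m k)
      * mono_eval (m - Poly_Mapping.single k 1) (v + t *s w)))) (at t)"
proof -
  define x where "x = v + t *s w"
  have "((\<lambda>t. \<Prod>k\<in>UNIV. (v $ k + t * w $ k) ^ Poly_Mapping.lookup m k) has_field_derivative
    (\<Sum>k\<in>UNIV. (of_nat (Poly_Mapping.lookup m k) * (w $ k * x $ k ^ (Poly_Mapping.lookup m k - 1)))
      * (\<Prod>j\<in>UNIV - {k}. (v $ j + t * w $ j) ^ Poly_Mapping.lookup m j))) (at t)"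
    by (rule has_field_derivative_prod)
      (auto intro!: derivative_eq_intros simp: x_def)
  moreover have "x $ k ^ (Poly_Mapping.lookup m k - 1) *
      (\<Prod>j\<in>UNIV - {k}. (v $ j + t * w $ j) ^ Poly_Mapping.lookup m j)
     = mono_eval (m - Poly_Mapping.single k 1) x" for k
    unfolding mono_eval_def
    by (subst prod.remove[of UNIV k])
      (auto simp: lookup_minus lookup_single x_def when_def intro!: prod.cong)
  ultimately show ?thesis
    by (simp add: mono_eval_def[of m] x_def mult_ac)
qed

lemma eval_deriv:
  "((\<lambda>t. eval p (v + t *s w)) has_field_derivative dir_deriv p (v + t *s w) w) (at t)"
proof -
  have "((\<lambda>t. eval p (v + t *s w)) has_field_derivative
    (\<Sum>m\<in>Poly_Mapping.keys p. Poly_Mapping.lookup p m * (\<Sum>k\<in>UNIV. w $ k * (of_nat (Poly_Mapping.lookup m k)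
      * mono_eval (m - Poly_Mapping.single k 1) (v + t *s w))))) (at t)"
    unfolding eval_eq_sum[OF finite_keys subset_refl]
    by (intro DERIV_sum DERIV_cmult mono_eval_deriv)
  also have "(\<Sum>m\<in>Poly_Mapping.keys p. Poly_Mapping.lookup p m * (\<Sum>k\<in>UNIV. w $ k * (of_nat (Poly_Mapping.lookup m k)
      * mono_eval (m - Poly_Mapping.single k 1) (v + t *s w)))) = dir_deriv p (v + t *s w) w"
    unfolding dir_deriv_def eval_partial sum_distrib_left
    by (subst sum.swap) (simp add: mult_ac)
  finally show ?thesis .
qed

lemma eval_deriv_0: "((\<lambda>t. eval p (v + t *s w)) has_field_derivative dir_deriv p v w) (at 0)"
  using eval_deriv[of p v w 0] by simp

lemma dir_deriv_mult: "dir_deriv (p * q) v w = dir_deriv p v w * eval q v + eval p v * dir_deriv q v w"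
proof -
  have "((\<lambda>t. eval (p * q) (v + t *s w)) has_field_derivative
     dir_deriv p v w * eval q v + eval p v * dir_deriv q v w) (at 0)"
    using DERIV_mult[OF eval_deriv_0[of p v w] eval_deriv_0[of q v w]] by (simp add: mult_ac)
  then show ?thesis using DERIV_unique eval_deriv_0 by blast
qed

lemma dir_deriv_add_right: "dir_deriv p v (w + w') = dir_deriv p v w + dir_deriv p v w'"
  by (simp add: dir_deriv_def distrib_right sum.distrib)

lemma dir_deriv_scale_right: "dir_deriv p v (c *s w) = c * dir_deriv p v w"
  by (simp add: dir_deriv_def sum_distrib_left mult_ac)

text \<open>
  Euler's identity, by differentiating \<open>p ((1 + t) v) = (1 + t)\<^sup>k p v\<close>.
\<close>
lemma dir_deriv_self:
  assumes "p \<in> homog k"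
  shows "dir_deriv p v v = of_nat k * eval p v"
proof -
  have "v + t *s v = (1 + t) *s v" for t
    by (simp add: vec_eq_iff algebra_simps)
  then have "(\<lambda>t. eval p (v + t *s v)) = (\<lambda>t. (1 + t) ^ k * eval p v)"
    unfolding eval_scale[OF assms, symmetric] by metis
  moreover have "((\<lambda>t. (1 + t) ^ k * eval p v) has_field_derivative of_nat k * eval p v) (at 0)"
    by (auto intro!: derivative_eq_intros)
  ultimately show ?thesis using DERIV_unique eval_deriv_0 by metis
qed

lemma dir_deriv_constant:
  assumes "\<And>t. eval p (v + t *s w) = eval p v"
  shows "dir_deriv p v w = 0"
proof -
  have "((\<lambda>t. eval p (v + t *s w)) has_field_derivative 0) (at 0)"
    using assms by simp
  then show ?thesis using DERIV_unique eval_deriv_0 by metis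
qed

section \<open>Brackets\<close>

text \<open>
  The bilinear, not the Hermitian, pairing: \<open>cdot n v\<close> is the value at \<open>v\<close> of the linear form
  with coefficient vector \<open>n\<close>.
\<close>
definition cdot :: "complex^3 \<Rightarrow> complex^3 \<Rightarrow> complex" where
  "cdot u v = u $ 1 * v $ 1 + u $ 2 * v $ 2 + u $ 3 * v $ 3"

definition ccross :: "complex^3 \<Rightarrow> complex^3 \<Rightarrow> complex^3" where
  "ccross u v = vector [u $ 2 * v $ 3 - u $ 3 * v $ 2, u $ 3 * v $ 1 - u $ 1 * v $ 3,
     u $ 1 * v $ 2 - u $ 2 * v $ 1]"

text \<open>
  The determinant of three vectors. It vanishes exactly when the three points are collinear, and
  \<open>bracket u v\<close> is a linear form whose zero set is the join of \<open>u\<close> and \<open>v\<close>.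
\<close>
definition bracket :: "complex^3 \<Rightarrow> complex^3 \<Rightarrow> complex^3 \<Rightarrow> complex" where
  "bracket u v w = cdot (ccross u v) w"

lemma ccross_nth [simp]:
  "ccross u v $ 1 = u $ 2 * v $ 3 - u $ 3 * v $ 2"
  "ccross u v $ 2 = u $ 3 * v $ 1 - u $ 1 * v $ 3"
  "ccross u v $ 3 = u $ 1 * v $ 2 - u $ 2 * v $ 1"
  by (simp_all add: ccross_def)

lemma vec3_eq_iff: "u = v \<longleftrightarrow> u $ 1 = v $ 1 \<and> u $ 2 = v $ 2 \<and> u $ 3 = v $ 3" for u v :: "complex^3"
  by (simp add: vec_eq_iff forall_3)

lemmas bracket_defs = bracket_def cdot_def vec3_eq_iff

lemma cdot_add_right [simp]: "cdot n (u + v) = cdot n u + cdot n v"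
  and cdot_diff_right [simp]: "cdot n (u - v) = cdot n u - cdot n v"
  and cdot_scale_right [simp]: "cdot n (c *s v) = c * cdot n v"
  and cdot_zero_right [simp]: "cdot n 0 = 0"
  and cdot_scale_left [simp]: "cdot (c *s n) v = c * cdot n v"
  and cdot_zero_left [simp]: "cdot 0 v = 0"
  and cdot_diff_left: "cdot (m - n) v = cdot m v - cdot n v"
  and cdot_add_left: "cdot (m + n) v = cdot m v + cdot n v"
  by (simp_all add: cdot_def algebra_simps)

lemma cdot_commute: "cdot u v = cdot v u"
  by (simp add: cdot_def mult.commute)

lemma ccross_add_right: "ccross w (u + v) = ccross w u + ccross w v"
  and ccross_scale_right: "ccross w (c *s v) = c *s ccross w v"
  and ccross_add_left: "ccross (u + v) w = ccross u w + ccross v w"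
  and ccross_scale_left: "ccross (c *s v) w = c *s ccross v w"
  and ccross_self [simp]: "ccross v v = 0"
  and ccross_zero_right [simp]: "ccross v 0 = 0"
  and ccross_zero_left [simp]: "ccross 0 v = 0"
  by (simp_all add: vec3_eq_iff algebra_simps)

lemma ccross_minus_commute: "ccross u v = - ccross v u"
  by (simp add: vec3_eq_iff)

lemma bracket_swap23: "bracket u w v = - bracket u v w"
  and bracket_rotate: "bracket v w u = bracket u v w"
  and bracket_repeat [simp]: "bracket u u w = 0" "bracket u w u = 0" "bracket w u u = 0"
  and bracket_zero [simp]: "bracket u v 0 = 0"
  by (simp_all add: bracket_defs algebra_simps)

lemma ccross_eq_0D:
  assumes "ccross u v = 0" "u \<noteq> 0"
  obtains c where "v = c *s u"
proof -
  from assms(2) consider "u $ 1 \<noteq> 0" | "u $ 2 \<noteq> 0" | "u $ 3 \<noteq> 0"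
    by (auto simp: vec3_eq_iff)
  then have "\<exists>c. v = c *s u"
  proof cases
    case 1
    then have "v = (v $ 1 / u $ 1) *s u"
      using assms(1) by (simp add: vec3_eq_iff field_simps)
    then show ?thesis ..
  next
    case 2
    then have "v = (v $ 2 / u $ 2) *s u"
      using assms(1) by (simp add: vec3_eq_iff field_simps)
    then show ?thesis ..
  next
    case 3
    then have "v = (v $ 3 / u $ 3) *s u"
      using assms(1) by (simp add: vec3_eq_iff field_simps)
    then show ?thesis ..
  qed
  then show thesis using that by blast
qed

lemma exists_cdot_eq_1:
  assumes "n \<noteq> 0" obtains e where "cdot n e = 1"
proof -
  from assms consider "n $ 1 \<noteq> 0" | "n $ 2 \<noteq> 0" | "n $ 3 \<noteq> 0"
    by (auto simp: vec3_eq_iff)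
  then show thesis
  proof cases
    case 1 then show thesis by (intro that[of "vector [1 / n $ 1, 0, 0]"]) (simp add: cdot_def)
  next
    case 2 then show thesis by (intro that[of "vector [0, 1 / n $ 2, 0]"]) (simp add: cdot_def)
  next
    case 3 then show thesis by (intro that[of "vector [0, 0, 1 / n $ 3]"]) (simp add: cdot_def)
  qed
qed

text \<open>
  Four vectors in a three-dimensional space are dependent; applied to three vertices and a
  fourth, this is the source of the linear relation between the lines through the fourth.
\<close>
lemma cramer:
  "bracket u v w *s x = bracket x v w *s u + bracket u x w *s v + bracket u v x *s w"
  by (simp add: bracket_defs algebra_simps)

lemma plane_spanned:
  assumes "ccross u v \<noteq> 0" "bracket u v x = 0"
  obtains s t where "x = s *s u + t *s v"
proof -
  obtain e where "bracket u v e = 1"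
    unfolding bracket_def using exists_cdot_eq_1[OF assms(1)] by blast
  then have "x = bracket x v e *s u + bracket u x e *s v"
    using cramer[of u v e x] assms(2) by simp
  then show thesis by (rule that)
qed

lemma ccross_ccross: "ccross n (ccross u v) = cdot n v *s u - cdot n u *s v"
  by (simp add: bracket_defs algebra_simps)

lemma ccross_of_ccross_same_right: "ccross (ccross u w) (ccross v w) = bracket u v w *s w"
  by (simp add: bracket_defs algebra_simps)

lemma ccross_of_ccross_same_left: "ccross (ccross w u) (ccross w v) = bracket u v w *s w"
  by (simp add: bracket_defs algebra_simps)

lemma normal_of_plane:
  assumes "ccross u v \<noteq> 0" "cdot n u = 0" "cdot n v = 0"
  obtains k where "n = k *s ccross u v"
proof -
  have "ccross (ccross u v) n = 0"
    using ccross_ccross[of n u v] ccross_minus_commute[of "ccross u v" n] assms(2,3) by simp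
  with assms(1) show thesis by (elim ccross_eq_0D that)
qed

lemma cdot_ccross [simp]: "cdot (ccross u v) u = 0" "cdot (ccross u v) v = 0"
  by (simp_all add: cdot_def algebra_simps)

lemma bracket_nonzeroD:
  assumes "bracket u v w \<noteq> 0"
  shows "u \<noteq> 0" "v \<noteq> 0" "w \<noteq> 0" "ccross u v \<noteq> 0" "ccross v w \<noteq> 0" "ccross u w \<noteq> 0"
proof -
  have "bracket u v w = cdot (ccross v w) u" "bracket u v w = - cdot (ccross u w) v"
    by (simp_all add: cdot_def bracket_def algebra_simps)
  with assms show "u \<noteq> 0" "v \<noteq> 0" "w \<noteq> 0" "ccross u v \<noteq> 0" "ccross v w \<noteq> 0" "ccross u w \<noteq> 0"
    by (auto simp: bracket_def)
qed

lemma eq_0_of_parallel_to_two: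
  assumes "ccross w m = 0" "ccross w n = 0" "ccross m n \<noteq> 0"
  shows "w = 0"
proof (rule ccontr)
  assume "w \<noteq> 0"
  then obtain c d where "m = c *s w" "n = d *s w" using assms ccross_eq_0D by metis
  with assms(3) show False by (simp add: ccross_scale_left ccross_scale_right)
qed

lemma common_point_unique:
  assumes "ccross m n \<noteq> 0" "cdot m u = 0" "cdot n u = 0" "cdot m v = 0" "cdot n v = 0" "u \<noteq> 0"
  obtains c where "v = c *s u"
proof -
  obtain k l where kl: "u = k *s ccross m n" "v = l *s ccross m n"
    using assms normal_of_plane[of m n] by (metis cdot_commute)
  with \<open>u \<noteq> 0\<close> have "k \<noteq> 0" by auto
  with kl have "v = (l / k) *s u" by (simp add: vec3_eq_iff)
  then show thesis by (rule that)
qed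

section \<open>Functions that are polynomial along every line\<close>

text \<open>
  This single property carries all arguments on zeros: it is stable under sums and products, and
  a function with it is controlled by its zeros on a well chosen line.
\<close>
definition line_poly :: "nat \<Rightarrow> (complex^3 \<Rightarrow> complex) \<Rightarrow> bool" where
  "line_poly d F \<longleftrightarrow> (\<forall>v w. \<exists>p. degree p \<le> d \<and> (\<forall>t. F (v + t *s w) = poly p t))"

lemma line_polyE:
  assumes "line_poly d F"
  obtains p where "degree p \<le> d" "\<And>t. F (v + t *s w) = poly p t"
  using assms unfolding line_poly_def by blast

lemma line_poly_const: "line_poly 0 (\<lambda>_. c)"
  unfolding line_poly_def by (auto intro!: exI[of _ "[:c:]"])

lemma line_poly_mono: "line_poly d F \<Longrightarrow> d \<le> e \<Longrightarrow> line_poly e F"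
  unfolding line_poly_def by (meson order_trans)

lemma line_poly_add: "line_poly d F \<Longrightarrow> line_poly d G \<Longrightarrow> line_poly d (\<lambda>v. F v + G v)"
  unfolding line_poly_def by (metis degree_add_le poly_add)

lemma line_poly_diff: "line_poly d F \<Longrightarrow> line_poly d G \<Longrightarrow> line_poly d (\<lambda>v. F v - G v)"
  unfolding line_poly_def by (metis degree_diff_le poly_diff)

lemma line_poly_mult: "line_poly d F \<Longrightarrow> line_poly e G \<Longrightarrow> line_poly (d + e) (\<lambda>v. F v * G v)"
  unfolding line_poly_def
proof (intro allI)
  fix v w
  assume "\<forall>v w. \<exists>p. degree p \<le> d \<and> (\<forall>t. F (v + t *s w) = poly p t)"
    "\<forall>v w. \<exists>p. degree p \<le> e \<and> (\<forall>t. G (v + t *s w) = poly p t)"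
  then obtain p q where "degree p \<le> d" "\<forall>t. F (v + t *s w) = poly p t"
    "degree q \<le> e" "\<forall>t. G (v + t *s w) = poly q t" by meson
  then show "\<exists>p. degree p \<le> d + e \<and> (\<forall>t. F (v + t *s w) * G (v + t *s w) = poly p t)"
    by (intro exI[of _ "p * q"]) (auto intro: degree_mult_le[THEN order_trans])
qed

lemma line_poly_cmult: "line_poly d F \<Longrightarrow> line_poly d (\<lambda>v. c * F v)"
  using line_poly_mult[OF line_poly_const] by simp

lemma line_poly_sum:
  "(\<And>x. x \<in> A \<Longrightarrow> line_poly d (F x)) \<Longrightarrow> line_poly d (\<lambda>v. \<Sum>x\<in>A. F x v)"
proof (induction A rule: infinite_finite_induct)
  case (insert x A)
  then show ?case by (simp add: line_poly_add)
qed (simp_all add: line_poly_mono[OF line_poly_const])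

lemma line_poly_prod:
  "(\<And>x. x \<in> A \<Longrightarrow> line_poly 1 (F x)) \<Longrightarrow> line_poly (card A) (\<lambda>v. \<Prod>x\<in>A. F x v)"
proof (induction A rule: infinite_finite_induct)
  case (insert x A)
  then show ?case using line_poly_mult[of 1 "F x" "card A"] by simp
qed (simp_all add: line_poly_const)

lemma line_poly_nth: "line_poly 1 (\<lambda>v. v $ i)"
  unfolding line_poly_def
proof (intro allI)
  fix v w :: "complex^3"
  show "\<exists>p. degree p \<le> 1 \<and> (\<forall>t. (v + t *s w) $ i = poly p t)"
    by (intro exI[of _ "[:v $ i, w $ i:]"]) auto
qed

lemma line_poly_cdot: "line_poly 1 (cdot n)"
  unfolding cdot_def by (intro line_poly_add line_poly_cmult line_poly_nth)

lemma line_poly_mono_eval: "line_poly (mon_degree m) (mono_eval m)"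
proof -
  have pow: "line_poly k (\<lambda>v. (v $ i) ^ k)" for i :: 3 and k
  proof (induction k)
    case (Suc k)
    then show ?case using line_poly_mult[OF line_poly_nth[of i] Suc] by simp
  qed (simp add: line_poly_const)
  have "mono_eval m = (\<lambda>v. (v $ 1) ^ Poly_Mapping.lookup m 1
      * (v $ 2) ^ Poly_Mapping.lookup m 2 * (v $ 3) ^ Poly_Mapping.lookup m 3)"
    by (rule ext) (unfold mono_eval_def UNIV_3, simp)
  moreover have "mon_degree m = Poly_Mapping.lookup m 1 + Poly_Mapping.lookup m 2 + Poly_Mapping.lookup m 3"
    by (simp add: mon_degree_def sum_3)
  ultimately show ?thesis
    by (simp only:) (intro line_poly_mult pow)
qed

lemma line_poly_eval: "p \<in> homog d \<Longrightarrow> line_poly d (eval p)"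
  unfolding eval_eq_sum[OF finite_keys subset_refl, THEN ext]
  by (intro line_poly_sum line_poly_cmult) (use line_poly_mono_eval in \<open>auto simp: homog_def\<close>)

lemma line_poly_eval_ex: "\<exists>d. line_poly d (eval p)"
proof -
  have "line_poly (\<Sum>m\<in>Poly_Mapping.keys p. mon_degree m) (eval p)"
    unfolding eval_eq_sum[OF finite_keys subset_refl, abs_def]
    by (intro line_poly_sum line_poly_cmult line_poly_mono[OF line_poly_mono_eval] member_le_sum)
      auto
  then show ?thesis ..
qed

text \<open>
  Inside the plane, the line from \<open>v\<close> to any \<open>u\<close> carries two polynomials with product zero, and
  the second is nonzero because \<open>G v \<noteq> 0\<close>.
\<close>
lemma line_poly_cancel_on_plane:
  assumes F: "line_poly d F" and G: "line_poly e G"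
    and zero: "\<And>v. cdot n v = 0 \<Longrightarrow> F v * G v = 0"
    and v: "cdot n v = 0" "G v \<noteq> 0" and u: "cdot n u = 0"
  shows "F u = 0"
proof -
  obtain p where p: "\<And>t. F (v + t *s (u - v)) = poly p t" by (rule line_polyE[OF F, of v "u - v"]) blast
  obtain q where q: "\<And>t. G (v + t *s (u - v)) = poly q t" by (rule line_polyE[OF G, of v "u - v"]) blast
  have "poly (p * q) t = 0" for t
    using zero[of "v + t *s (u - v)"] v(1) u by (simp add: p[symmetric] q[symmetric])
  then have "p * q = 0" using poly_all_0_iff_0 by blast
  moreover have "q \<noteq> 0" using q[of 0] v(2) by auto
  ultimately have "p = 0" by simp
  with p[of 1] show ?thesis by simp
qed

text \<open>
  The curve \<open>(1, t, t\<^sup>2)\<close> meets each plane in at most two points.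
\<close>
lemma avoid_planes:
  assumes "finite N" "0 \<notin> N"
  obtains w where "\<And>n. n \<in> N \<Longrightarrow> cdot n w \<noteq> 0"
proof -
  define p where "p n = [:n $ 1, n $ 2, n $ 3:]" for n :: "complex^3"
  have "finite (\<Union>n\<in>N. {t. poly (p n) t = 0})"
  proof (intro finite_UN_I poly_roots_finite)
    fix n assume "n \<in> N"
    with assms have "n \<noteq> 0" by blast
    then show "p n \<noteq> 0" by (auto simp: p_def vec3_eq_iff)
  qed (use assms in auto)
  then obtain t where "t \<notin> (\<Union>n\<in>N. {t. poly (p n) t = 0})"
    using ex_new_if_finite infinite_UNIV_char_0 by blast
  then have "cdot n (vector [1, t, t^2]) \<noteq> 0" if "n \<in> N" for n
    using that by (auto simp: p_def cdot_def power2_eq_square algebra_simps)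
  then show thesis by (rule that)
qed

text \<open>
  A line through \<open>v\<close> in a generic direction meets the excluded planes in finitely many points only.
\<close>
lemma line_poly_zero_off_planes:
  assumes F: "line_poly d F" and N: "finite N" "0 \<notin> N"
    and zero: "\<And>v. (\<And>n. n \<in> N \<Longrightarrow> cdot n v \<noteq> 0) \<Longrightarrow> F v = 0"
  shows "F v = 0"
proof -
  obtain w where w: "\<And>n. n \<in> N \<Longrightarrow> cdot n w \<noteq> 0" using avoid_planes[OF N] by blast
  obtain p where p: "\<And>t. F (v + t *s w) = poly p t" by (rule line_polyE[OF F, of v w]) blast
  have "poly p t = 0" if "t \<notin> (\<lambda>n. - cdot n v / cdot n w) ` N" for t
  proof -
    have "cdot n (v + t *s w) \<noteq> 0" if "n \<in> N" for n
    proof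
      assume "cdot n (v + t *s w) = 0"
      then have "t = - cdot n v / cdot n w"
        using w[OF \<open>n \<in> N\<close>] by (simp add: field_simps eq_neg_iff_add_eq_0)
      with \<open>t \<notin> _\<close> \<open>n \<in> N\<close> show False by blast
    qed
    then show ?thesis using zero p by metis
  qed
  then have "- ((\<lambda>n. - cdot n v / cdot n w) ` N) \<subseteq> {t. poly p t = 0}" by blast
  moreover have "infinite (- ((\<lambda>n. - cdot n v / cdot n w) ` N))"
    using N(1) by (simp add: infinite_UNIV_char_0 Compl_eq_Diff_UNIV Diff_infinite_finite)
  ultimately have "p = 0" using poly_roots_finite finite_subset by blast
  with p[of 0] show ?thesis by simp
qed

text \<open>
  A generic line meets the planes in \<open>card I\<close> different points, more than a nonzero polynomial of
  degree \<open>d\<close> can have as zeros.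
\<close>
lemma line_poly_zero_of_many_planes:
  assumes F: "line_poly d F" and I: "finite I" "d < card I"
    and indep: "\<And>x y. x \<in> I \<Longrightarrow> y \<in> I \<Longrightarrow> x \<noteq> y \<Longrightarrow> ccross (n x) (n y) \<noteq> 0"
    and n0: "\<And>x. x \<in> I \<Longrightarrow> n x \<noteq> 0"
    and zero: "\<And>x v. x \<in> I \<Longrightarrow> cdot (n x) v = 0 \<Longrightarrow> F v = 0"
  shows "F v = 0"
proof -
  obtain w where w: "\<And>x. x \<in> I \<Longrightarrow> cdot (n x) w \<noteq> 0"
    using avoid_planes[of "n ` I"] I n0 by (metis finite_imageI imageE imageI)
  \<comment> \<open>The line through \<open>u\<close> in direction \<open>w\<close> meets the planes \<open>x\<close> and \<open>y\<close> in the same point iff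
    \<open>cdot (m x y) u = 0\<close>.\<close>
  define m where "m x y = cdot (n y) w *s n x - cdot (n x) w *s n y" for x y
  have m: "cdot (m x y) u = cdot (n y) w * cdot (n x) u - cdot (n x) w * cdot (n y) u" for x y u
    by (simp add: m_def cdot_diff_left)
  define N where "N = (\<lambda>(x, y). m x y) ` {(x, y). x \<in> I \<and> y \<in> I \<and> x \<noteq> y}"
  show ?thesis
  proof (rule line_poly_zero_off_planes[OF F, of N])
    have "{(x, y). x \<in> I \<and> y \<in> I \<and> x \<noteq> y} \<subseteq> I \<times> I" by blast
    then show "finite N" unfolding N_def using I(1) finite_subset by blast
    show "0 \<notin> N"
    proof
      assume "0 \<in> N"
      then obtain x y where xy: "x \<in> I" "y \<in> I" "x \<noteq> y" "m x y = 0" unfolding N_def by auto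
      then have eq: "cdot (n y) w *s n x = cdot (n x) w *s n y" by (simp add: m_def)
      have "cdot (n y) w *s ccross (n x) (n y) = ccross (cdot (n y) w *s n x) (n y)"
        by (simp add: ccross_scale_left)
      also have "\<dots> = 0" by (simp add: eq ccross_scale_left)
      finally show False using w[of y] indep[of x y] xy by simp
    qed
    fix u assume u: "\<And>k. k \<in> N \<Longrightarrow> cdot k u \<noteq> 0"
    obtain p where p: "degree p \<le> d" "\<And>t. F (u + t *s w) = poly p t" by (rule line_polyE[OF F, of u w]) blast
    define r where "r x = - cdot (n x) u / cdot (n x) w" for x
    have "inj_on r I"
    proof (rule inj_onI, rule ccontr)
      fix x y assume xy: "x \<in> I" "y \<in> I" "r x = r y" "x \<noteq> y"
      then have "cdot (m x y) u = 0"
        using w[of x] w[of y] by (simp add: m r_def field_simps)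
      moreover have "m x y \<in> N" using xy by (auto simp: N_def)
      ultimately show False using u by blast
    qed
    moreover have "poly p (r x) = 0" if "x \<in> I" for x
      using zero[OF that, of "u + r x *s w"] w[OF that] by (simp add: p(2)[symmetric] r_def)
    then have "r ` I \<subseteq> {t. poly p t = 0}" by blast
    ultimately have "p = 0"
      using card_poly_roots_bound[of p] p(1) I poly_roots_finite[of p] card_image[of r I]
        card_mono[of "{t. poly p t = 0}" "r ` I"] by linarith
    with p(2)[of 0] show "F u = 0" by simp
  qed
qed

text \<open>
  The coefficient of \<open>t\<^sup>d\<close> in \<open>F (v + t w)\<close> is the value of \<open>F\<close> at the point \<open>w\<close> at infinity of
  this line.
\<close>
lemma line_poly_degree_drop:
  assumes F: "line_poly d F" and hom: "\<And>c v. F (c *s v) = c ^ d * F v" and w: "F w = 0" and d: "d > 0"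
  obtains p where "degree p < d" "\<And>t. F (v + t *s w) = poly p t"
proof -
  obtain p where p: "degree p \<le> d" "\<And>t. F (v + t *s w) = poly p t" by (rule line_polyE[OF F, of v w]) blast
  obtain q where q: "\<And>t. F (w + t *s v) = poly q t" by (rule line_polyE[OF F, of w v]) blast
  have "degree p < d"
  proof (rule ccontr)
    assume "\<not> degree p < d"
    with p(1) have deg: "degree p = d" by simp
    have "poly (reflect_poly p) s = poly q s" if "s \<noteq> 0" for s
    proof -
      have "w + s *s v = s *s (v + inverse s *s w)" using that by (simp add: vec3_eq_iff distrib_left mult.assoc[symmetric])
      then have "poly q s = s ^ d * poly p (inverse s)" using q[of s] hom p(2) by metis
      also have "\<dots> = poly (reflect_poly p) s"
        using poly_reflect_poly_nz[OF that, of p] deg by simp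
      finally show ?thesis by simp
    qed
    then have "- {0} \<subseteq> {s. poly (reflect_poly p - q) s = 0}" by auto
    moreover have "infinite (- {0 :: complex})"
      by (simp add: infinite_UNIV_char_0 Compl_eq_Diff_UNIV Diff_infinite_finite)
    ultimately have "reflect_poly p - q = 0" using poly_roots_finite finite_subset by blast
    then have "poly (reflect_poly p) 0 = 0" using q[of 0] w by simp
    then show False using deg d by auto
  qed
  then show thesis using p(2) by (rule that)
qed

lemma poly_multiple_of_linear_factors:
  fixes p :: "complex poly"
  assumes X: "finite X" and deg: "degree p \<le> card X"
    and b: "\<And>x. x \<in> X \<Longrightarrow> b x \<noteq> 0"
    and ab: "\<And>x y. x \<in> X \<Longrightarrow> y \<in> X \<Longrightarrow> x \<noteq> y \<Longrightarrow> a x * b y \<noteq> a y * b x"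
    and root: "\<And>x t. x \<in> X \<Longrightarrow> a x + t * b x = 0 \<Longrightarrow> poly p t = 0"
  obtains c where "\<And>t. poly p t = c * (\<Prod>x\<in>X. a x + t * b x)"
proof -
  define q where "q = (\<Prod>x\<in>X. [:a x, b x:])"
  have q: "poly q t = (\<Prod>x\<in>X. a x + t * b x)" for t by (simp add: q_def poly_prod)
  have degq: "degree q \<le> card X"
    unfolding q_def using b X by (subst degree_prod_eq_sum_degree) auto
  have "q \<noteq> 0" unfolding q_def using X b by auto
  then obtain z where z: "poly q z \<noteq> 0" using poly_all_0_iff_0 by blast
  define c where "c = poly p z / poly q z"
  define r where "r x = - a x / b x" for x
  let ?e = "p - smult c q"
  have r: "a x + r x * b x = 0" if "x \<in> X" for x using b[OF that] by (simp add: r_def)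
  have "?e = 0"
  proof (rule ccontr)
    assume e: "?e \<noteq> 0"
    have inj: "inj_on r X"
    proof (rule inj_onI, rule ccontr)
      fix x y assume "x \<in> X" "y \<in> X" "r x = r y" "x \<noteq> y"
      then show False using ab[of x y] b[of x] b[of y] by (simp add: r_def field_simps)
    qed
    have "z \<notin> r ` X" using z r X by (auto simp: q prod_zero_iff)
    then have "card (insert z (r ` X)) = Suc (card X)" using X inj by (simp add: card_image)
    moreover have "insert z (r ` X) \<subseteq> {t. poly ?e t = 0}"
    proof -
      have "poly q (r x) = 0" if "x \<in> X" for x using X r that by (auto simp: q)
      then show ?thesis using root r z by (auto simp: c_def)
    qed
    ultimately have "Suc (card X) \<le> degree ?e"
      using card_poly_roots_bound[OF e] poly_roots_finite[OF e] card_mono by (metis order_trans)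
    moreover have "degree ?e \<le> card X"
      using deg degq degree_smult_le[of c q] by (intro degree_diff_le) auto
    ultimately show False by simp
  qed
  then have "poly p t = c * (\<Prod>x\<in>X. a x + t * b x)" for t by (simp add: q[symmetric])
  then show thesis by (rule that)
qed

section \<open>Linear forms\<close>

definition linform :: "complex^3 \<Rightarrow> poly3" where
  "linform n = (\<Sum>k\<in>UNIV. const (n $ k) * var k)"

lemma eval_linform [simp]: "eval (linform n) v = cdot n v"
  by (simp add: linform_def eval_sum sum_3 cdot_def)

lemma homog_linform [simp, intro]: "linform n \<in> homog 1"
  unfolding linform_def by (intro homog_sum homog_const_mult homog_var)

lemma homog_1_eq_linform:
  assumes "p \<in> homog 1" obtains n where "p = linform n"
proof -
  have "p = linform (\<chi> k. eval (partial k p) 0)"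
  proof (rule poly3_eqI)
    fix v
    have "eval p v = (\<Sum>k\<in>UNIV. v $ k * eval (partial k p) v)"
      using dir_deriv_self[OF assms, of v] by (simp add: dir_deriv_def)
    also have "\<dots> = (\<Sum>k\<in>UNIV. v $ k * eval (partial k p) 0)"
    proof (rule sum.cong)
      fix k
      have "partial k p \<in> homog 0" using homog_partial[of p 0 k] assms by simp
      then show "v $ k * eval (partial k p) v = v $ k * eval (partial k p) 0"
        using eval_homog_0 by metis
    qed simp
    finally show "eval p v = eval (linform (\<chi> k. eval (partial k p) 0)) v"
      by (simp add: sum_3 cdot_def mult.commute)
  qed
  then show thesis by (rule that)
qed

lemma dir_deriv_linform [simp]: "dir_deriv (linform n) v w = cdot n w"
proof -
  have "((\<lambda>t. eval (linform n) (v + t *s w)) has_field_derivative cdot n w) (at 0)"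
    by (auto intro!: derivative_eq_intros)
  then show ?thesis using DERIV_unique eval_deriv_0 by blast
qed

text \<open>
  The conics through the four points \<open>p3, q1, q2, q3\<close> form a pencil spanned by the line pairs
  \<open>p3q1, q3q2\<close> and \<open>p3q2, q3q1\<close>. The coefficients are chosen so that the conic passes through
  \<open>p1\<close>, and the equation says that it passes through \<open>p2\<close>.
\<close>
lemma conic_through_six:
  assumes eq: "bracket p3 q2 p1 * bracket q3 q1 p1 * bracket p3 q1 p2 * bracket q3 q2 p2
       = bracket p3 q1 p1 * bracket q3 q2 p1 * bracket p3 q2 p2 * bracket q3 q1 p2"
    and nz: "bracket p3 q2 p1 \<noteq> 0" "bracket q3 q1 p1 \<noteq> 0" "bracket p3 q1 q2 \<noteq> 0" "bracket q3 q2 p3 \<noteq> 0"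
  obtains q where "q \<in> homog 2" "q \<noteq> 0" "\<And>v. v \<in> {p1, p2, p3, q1, q2, q3} \<Longrightarrow> eval q v = 0"
proof -
  define q where "q = const (bracket p3 q2 p1 * bracket q3 q1 p1) * (linform (ccross p3 q1) * linform (ccross q3 q2))
    - const (bracket p3 q1 p1 * bracket q3 q2 p1) * (linform (ccross p3 q2) * linform (ccross q3 q1))"
  have ev: "eval q v = bracket p3 q2 p1 * bracket q3 q1 p1 * (bracket p3 q1 v * bracket q3 q2 v)
     - bracket p3 q1 p1 * bracket q3 q2 p1 * (bracket p3 q2 v * bracket q3 q1 v)" for v
    by (simp add: q_def bracket_def)
  have "linform m * linform n \<in> homog 2" for m n
    using homog_mult[OF homog_linform homog_linform] by (simp add: numeral_2_eq_2)
  then have "q \<in> homog 2" unfolding q_def by (intro homog_diff homog_const_mult)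
  moreover have "q \<noteq> 0"
  proof
    assume "q = 0"
    moreover have "bracket p3 q2 (p3 + q2) = 0" "bracket p3 q1 (p3 + q2) = bracket p3 q1 q2"
      "bracket q3 q2 (p3 + q2) = bracket q3 q2 p3"
      by (simp_all add: bracket_def)
    ultimately show False using ev[of "p3 + q2"] nz by simp
  qed
  moreover have "eval q v = 0" if "v \<in> {p1, p2, p3, q1, q2, q3}" for v
    using that eq by (auto simp: ev mult_ac)
  ultimately show thesis by (rule that)
qed

section \<open>Hexagons as complete bipartite graphs\<close>

text \<open>
  The nine lines are the joins of the \<open>P i\<close> with the \<open>Q j\<close>, and \<open>K\<close> records that a linear form is
  determined by its line only up to a nonzero factor. The first two assumptions say that lines
  through a common vertex are different. Three lines no two of which share a vertex form a
  perfect matching of the graph; \<open>matching\<close> forbids that they are concurrent, which is how the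
  absence of further triple points enters.
\<close>
locale bipartite_hexagon =
  fixes P Q :: "3 \<Rightarrow> complex^3" and K :: "3 \<Rightarrow> 3 \<Rightarrow> complex"
  assumes PPQ: "a \<noteq> b \<Longrightarrow> bracket (P a) (P b) (Q j) \<noteq> 0"
    and QQP: "a \<noteq> b \<Longrightarrow> bracket (Q a) (Q b) (P j) \<noteq> 0"
    and K: "K i j \<noteq> 0"
    and matching: "distinct [a, b, c] \<Longrightarrow> distinct [j, k, l] \<Longrightarrow> v \<noteq> 0 \<Longrightarrow>
      bracket (P a) (Q j) v = 0 \<Longrightarrow> bracket (P b) (Q k) v = 0 \<Longrightarrow> bracket (P c) (Q l) v \<noteq> 0"
    and no_conic:
      "bracket (P 3) (Q 2) (P 1) * bracket (Q 3) (Q 1) (P 1) * bracket (P 3) (Q 1) (P 2) * bracket (Q 3) (Q 2) (P 2)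
       \<noteq> bracket (P 3) (Q 1) (P 1) * bracket (Q 3) (Q 2) (P 1) * bracket (P 3) (Q 2) (P 2) * bracket (Q 3) (Q 1) (P 2)"
begin

definition normal :: "3 \<times> 3 \<Rightarrow> complex^3" where
  "normal x = K (fst x) (snd x) *s ccross (P (fst x)) (Q (snd x))"

definition L :: "3 \<times> 3 \<Rightarrow> complex^3 \<Rightarrow> complex" where
  "L x v = cdot (normal x) v"

text \<open>
  The lines that share no vertex with the line \<open>x\<close>: they meet it in its double points.
\<close>
definition opp :: "3 \<times> 3 \<Rightarrow> (3 \<times> 3) set" where
  "opp x = (- {fst x}) \<times> (- {snd x})"

lemma L_eq_bracket: "L (i, j) v = K i j * bracket (P i) (Q j) v"
  by (simp add: L_def normal_def bracket_def)

lemma L_linear [simp]: "L x (u + v) = L x u + L x v" "L x (c *s v) = c * L x v" "L x 0 = 0"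
  by (simp_all add: L_def)

lemma L_own_P [simp]: "L x (P (fst x)) = 0" and L_own_Q [simp]: "L x (Q (snd x)) = 0"
  by (simp_all add: L_def normal_def)

lemma L_P: "fst x \<noteq> i \<Longrightarrow> L x (P i) \<noteq> 0"
  using K PPQ[of "fst x" i "snd x"] bracket_swap23[of "P (fst x)" "Q (snd x)" "P i"]
  by (cases x) (simp add: L_eq_bracket)

lemma L_Q: "snd x \<noteq> j \<Longrightarrow> L x (Q j) \<noteq> 0"
  using K QQP[of "snd x" j "fst x"] bracket_rotate[of "Q (snd x)" "Q j" "P (fst x)"]
  by (cases x) (simp add: L_eq_bracket)

lemma ccross_P_Q: "ccross (P i) (Q j) \<noteq> 0"
proof -
  obtain a :: 3 where "a \<noteq> i" by (metis zero_neq_one)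
  then show ?thesis using PPQ[of a i j] bracket_nonzeroD(5) by blast
qed

lemma normal_nonzero: "normal x \<noteq> 0"
  using ccross_P_Q K by (simp add: normal_def vec_eq_iff)

text \<open>
  The line \<open>x\<close> contains two vertices, and one of them is not on the line \<open>y\<close>.
\<close>
lemma normal_indep:
  assumes "x \<noteq> y" shows "ccross (normal x) (normal y) \<noteq> 0"
proof
  assume "ccross (normal x) (normal y) = 0"
  then obtain c where "normal y = c *s normal x" using ccross_eq_0D normal_nonzero by blast
  then have L: "L y v = c * L x v" for v by (simp add: L_def)
  from assms consider "fst y \<noteq> fst x" | "snd y \<noteq> snd x" by (auto simp: prod_eq_iff)
  then show False
    using L[of "P (fst x)"] L[of "Q (snd x)"] L_P[of y "fst x"] L_Q[of y "snd x"] by cases auto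
qed

lemma on_line:
  assumes "L x v = 0"
  obtains s t where "v = s *s P (fst x) + t *s Q (snd x)"
proof -
  have "bracket (P (fst x)) (Q (snd x)) v = 0"
    using assms K by (cases x) (simp add: L_eq_bracket)
  then show thesis using plane_spanned[OF ccross_P_Q] that by blast
qed

lemma card_opp: "card (opp x) = 4"
  by (simp add: opp_def card_cartesian_product Compl_eq_Diff_UNIV card_Diff_singleton)

text \<open>
  So the four lines of \<open>opp x\<close> meet the line \<open>x\<close> in four different points: if two of them share a
  vertex, this vertex is their only common point and does not lie on \<open>x\<close>; otherwise the three
  lines form a perfect matching.
\<close>
lemma double_points:
  assumes "y \<in> opp x" "z \<in> opp x" "y \<noteq> z" "v \<noteq> 0" "L x v = 0" "L y v = 0"
  shows "L z v \<noteq> 0"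
proof
  assume z: "L z v = 0"
  have ne: "fst y \<noteq> fst x" "fst z \<noteq> fst x" "snd y \<noteq> snd x" "snd z \<noteq> snd x"
    using assms(1,2) by (auto simp: opp_def)
  have common: "\<exists>c. w = c *s v" if "L y w = 0" "L z w = 0" for w
    using common_point_unique[OF normal_indep[OF \<open>y \<noteq> z\<close>], of v w] that z assms(4,6)
    unfolding L_def by blast
  consider "fst y = fst z" | "snd y = snd z" | "fst y \<noteq> fst z" "snd y \<noteq> snd z" by blast
  then show False
  proof cases
    case 1
    then obtain c where "P (fst y) = c *s v" using common[of "P (fst y)"] by (metis L_own_P)
    then have "L x (P (fst y)) = 0" using assms(5) by simp
    then show False using L_P ne by metis
  next
    case 2
    then obtain c where "Q (snd y) = c *s v" using common[of "Q (snd y)"] by (metis L_own_Q)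
    then have "L x (Q (snd y)) = 0" using assms(5) by simp
    then show False using L_Q ne by metis
  next
    case 3
    then show False
      using matching[of "fst x" "fst y" "fst z" "snd x" "snd y" "snd z" v] ne assms z K
      by (cases x; cases y; cases z) (auto simp: L_eq_bracket)
  qed
qed

text \<open>
  The other lines meet the line \<open>x\<close> in finitely many points.
\<close>
lemma exists_off_other_lines:
  obtains v where "L x v = 0" "\<And>y. y \<noteq> x \<Longrightarrow> L y v \<noteq> 0"
proof -
  let ?p = "\<lambda>y. [:L y (P (fst x)), L y (Q (snd x)):]"
  have "finite (\<Union>y\<in>-{x}. {t. poly (?p y) t = 0})"
  proof (intro finite_UN_I poly_roots_finite)
    fix y assume "y \<in> - {x}"
    then consider "fst y \<noteq> fst x" | "snd y \<noteq> snd x" by (auto simp: prod_eq_iff)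
    then show "?p y \<noteq> 0" using L_P L_Q by cases auto
  qed auto
  then obtain t where t: "t \<notin> (\<Union>y\<in>-{x}. {t. poly (?p y) t = 0})"
    using ex_new_if_finite infinite_UNIV_char_0 by blast
  show thesis
    by (rule that[of "P (fst x) + t *s Q (snd x)"]) (use t in auto)
qed

lemma zero_on_all_lines:
  assumes "line_poly d F" "d < 9" "\<And>x v. L x v = 0 \<Longrightarrow> F v = 0"
  shows "F v = 0"
proof (rule line_poly_zero_of_many_planes[OF assms(1), of UNIV normal])
  show "d < card (UNIV :: (3 \<times> 3) set)" using assms(2) by simp
qed (use assms(3) normal_indep normal_nonzero in \<open>auto simp: L_def\<close>)

end

section \<open>Vector fields tangent to the nine lines\<close>

text \<open>
  The derivative \<open>B\<close> of \<open>\<omega>\<close> at \<open>V\<close> is linear and kills \<open>V\<close>, by Euler's identity. So \<open>B\<close> and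
  \<open>w \<mapsto> V \<times> w\<close> both live on the plane of vectors modulo \<open>V\<close>, the second one is injective there, and \<open>B\<close>
  is a multiple of it on each \<open>U j\<close>. A linear map of a plane with three eigendirections is a scalar.
\<close>
lemma vertex_slopes_equal:
  fixes \<omega> :: "3 \<Rightarrow> poly3" and U :: "3 \<Rightarrow> complex^3" and V :: "complex^3"
  assumes hom: "\<And>k. \<omega> k \<in> homog d" and zero: "\<And>k. eval (\<omega> k) V = 0"
    and indep: "\<And>a b. a \<noteq> b \<Longrightarrow> bracket (U a) (U b) V \<noteq> 0"
    and slope: "\<And>j k t. eval (\<omega> k) (V + t *s U j) = t * poly (g j) t * ccross V (U j) $ k"
  shows "poly (g a) 0 = poly (g b) 0"
proof -
  define B where "B w = (\<chi> k. dir_deriv (\<omega> k) V w)" for w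
  have B_lin: "B (u + v) = B u + B v" "B (c *s v) = c *s B v" for u v c
    by (simp_all add: B_def vec_eq_iff dir_deriv_add_right dir_deriv_scale_right)
  have BV: "B V = 0" by (simp add: B_def vec_eq_iff dir_deriv_self[OF hom] zero)
  have BU: "B (U j) = poly (g j) 0 *s ccross V (U j)" for j
  proof -
    have "((\<lambda>t. t * poly (g j) t * ccross V (U j) $ k) has_field_derivative
        poly (g j) 0 * ccross V (U j) $ k) (at 0)" for k
      by (auto intro!: derivative_eq_intros)
    then have "dir_deriv (\<omega> k) V (U j) = poly (g j) 0 * ccross V (U j) $ k" for k
      using DERIV_unique eval_deriv_0[of "\<omega> k" V "U j"] unfolding slope by blast
    then show ?thesis by (simp add: B_def vec_eq_iff)
  qed
  define c where "c j = poly (g j) 0" for j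
  have rel: "bracket (U 1) (U 2) (U 3) *s V = bracket V (U 2) (U 3) *s U 1
     + bracket (U 1) V (U 3) *s U 2 + bracket (U 1) (U 2) V *s U 3"
    by (rule cramer)
  have 1: "bracket V (U 2) (U 3) *s (c 1 *s ccross V (U 1)) + bracket (U 1) V (U 3) *s (c 2 *s ccross V (U 2))
     + bracket (U 1) (U 2) V *s (c 3 *s ccross V (U 3)) = 0"
    using arg_cong[OF rel, of B] by (simp add: B_lin BV BU c_def)
  have 2: "bracket V (U 2) (U 3) *s ccross V (U 1) + bracket (U 1) V (U 3) *s ccross V (U 2)
     + bracket (U 1) (U 2) V *s ccross V (U 3) = 0"
    using arg_cong[OF rel, of "ccross V"] by (simp add: ccross_add_right ccross_scale_right)
  have nz: "bracket V (U 2) (U 3) \<noteq> 0" "bracket (U 1) V (U 3) \<noteq> 0" "bracket V (U 1) (U 2) \<noteq> 0"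
    "bracket V (U 2) (U 1) \<noteq> 0"
    using indep[of 2 3] indep[of 1 3] indep[of 1 2] indep[of 2 1] bracket_rotate
      bracket_swap23[of "U 1" "U 3" V] by auto
  have "bracket V (U 2) (U 3) * (c 1 - c 3) * bracket V (U 1) (U 2) = 0"
    using arg_cong[OF 1, of "\<lambda>v. cdot v (U 2)"] arg_cong[OF 2, of "\<lambda>v. cdot v (U 2)"]
    unfolding bracket_def cdot_def by simp algebra
  then have "c 1 = c 3" using nz by simp
  have "bracket (U 1) V (U 3) * (c 2 - c 3) * bracket V (U 2) (U 1) = 0"
    using arg_cong[OF 1, of "\<lambda>v. cdot v (U 1)"] arg_cong[OF 2, of "\<lambda>v. cdot v (U 1)"]
    unfolding bracket_def cdot_def by simp algebra
  then have "c 2 = c 3" using nz by simp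
  with \<open>c 1 = c 3\<close> have "\<forall>j. c j = c 3" by (simp add: forall_3)
  then show ?thesis by (metis c_def)
qed

context bipartite_hexagon
begin

lemma cofactor_along_line:
  "\<exists>p. \<forall>t. c * (\<Prod>y\<in>opp x. L y (u + t *s v)) = poly p t"
proof -
  have "line_poly (card (opp x)) (\<lambda>v. \<Prod>y\<in>opp x. L y v)"
    unfolding L_def by (intro line_poly_prod line_poly_cdot)
  then have "line_poly (card (opp x)) (\<lambda>v. c * (\<Prod>y\<in>opp x. L y v))" by (rule line_poly_cmult)
  from line_polyE[OF this, of u v] show ?thesis by metis
qed

text \<open>
  Where two of the lines meet, \<open>\<omega>\<close> is a multiple of two independent normals and therefore
  vanishes. On the line \<open>P i Q j\<close> this happens at six points: the two vertices and the four points
  on the lines of \<open>opp (i, j)\<close>. A form of degree 6 with these zeros is determined up to the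
  factor \<open>c\<close>. The two equations are the same one in the affine charts around the two vertices.
\<close>
lemma restriction_to_edge:
  fixes \<omega> :: "3 \<Rightarrow> poly3"
  assumes hom: "\<And>k. \<omega> k \<in> homog 6"
    and tangent: "\<And>x v. L x v = 0 \<Longrightarrow> ccross (\<chi> k. eval (\<omega> k) v) (normal x) = 0"
  obtains c where
    "\<And>t k. eval (\<omega> k) (P i + t *s Q j)
       = t * (c * (\<Prod>y\<in>opp (i, j). L y (P i + t *s Q j))) * ccross (P i) (Q j) $ k"
    "\<And>t k. eval (\<omega> k) (Q j + t *s P i)
       = t * (c * (\<Prod>y\<in>opp (i, j). L y (Q j + t *s P i))) * ccross (P i) (Q j) $ k"
proof -
  define \<Omega> where "\<Omega> v = (\<chi> k. eval (\<omega> k) v)" for v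
  have scale: "\<Omega> (a *s v) = a ^ 6 *s \<Omega> v" for a v
    by (simp add: \<Omega>_def vec_eq_iff eval_scale[OF hom])
  have two: "\<Omega> v = 0" if "L x v = 0" "L y v = 0" "x \<noteq> y" for x y v
    using eq_0_of_parallel_to_two[OF tangent tangent normal_indep] that unfolding \<Omega>_def by blast
  obtain b :: 3 where b: "b \<noteq> j" by (metis zero_neq_one)
  obtain a :: 3 where a: "a \<noteq> i" by (metis zero_neq_one)
  have \<Omega>P: "\<Omega> (P i) = 0"
    using two[of "(i, j)" "P i" "(i, b)"] b L_own_P[of "(i, _)"] by simp
  have \<Omega>Q: "\<Omega> (Q j) = 0"
    using two[of "(i, j)" "Q j" "(a, j)"] a L_own_Q[of "(_, j)"] by simp
  let ?n = "ccross (P i) (Q j)" and ?x = "(i, j)"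
  obtain e where e: "cdot ?n e = 1" using exists_cdot_eq_1[OF ccross_P_Q] by blast
  define F where "F v = cdot (\<Omega> v) e" for v
  have on: "\<Omega> v = F v *s ?n" if "L ?x v = 0" for v
  proof -
    have "ccross (normal ?x) (\<Omega> v) = 0"
      using tangent[OF that] ccross_minus_commute[of "normal ?x" "\<Omega> v"] by (simp add: \<Omega>_def)
    then obtain c where "\<Omega> v = c *s normal ?x" using ccross_eq_0D normal_nonzero by blast
    then have c: "\<Omega> v = (c * K i j) *s ?n" by (simp add: normal_def)
    then have "F v = c * K i j" by (simp add: F_def e)
    with c show ?thesis by simp
  qed
  have L0: "L ?x (s *s P i + t *s Q j) = 0" for s t
    using L_own_P[of ?x] L_own_Q[of ?x] by simp
  have "F = (\<lambda>v. eval (\<omega> 1) v * e $ 1 + eval (\<omega> 2) v * e $ 2 + eval (\<omega> 3) v * e $ 3)"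
    by (simp add: F_def \<Omega>_def cdot_def fun_eq_iff)
  then have "F = (\<lambda>v. e $ 1 * eval (\<omega> 1) v + e $ 2 * eval (\<omega> 2) v + e $ 3 * eval (\<omega> 3) v)"
    by (simp add: mult.commute)
  then have F_poly: "line_poly 6 F"
    by (simp only:) (intro line_poly_add line_poly_cmult line_poly_eval hom)
  have F_scale: "F (a *s v) = a ^ 6 * F v" for a v by (simp add: F_def scale)
  have FP: "F (P i) = 0" and FQ: "F (Q j) = 0" by (simp_all add: F_def \<Omega>P \<Omega>Q)
  \<comment> \<open>The zero at \<open>Q j\<close> lies at infinity in this chart and shows in the degree.\<close>
  obtain p where p: "degree p < 6" "\<And>t. F (P i + t *s Q j) = poly p t"
    using line_poly_degree_drop[OF F_poly F_scale FQ] by auto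
  \<comment> \<open>The index of the line itself is free and stands for the zero at the vertex \<open>P i\<close>, where \<open>t = 0\<close>.\<close>
  define \<alpha> where "\<alpha> y = (if y = ?x then 0 else L y (P i))" for y
  define \<beta> where "\<beta> y = (if y = ?x then 1 else L y (Q j))" for y
  have opp: "?x \<notin> opp ?x" "finite (opp ?x)" by (auto simp: opp_def)
  have opp_nz: "L y (P i) \<noteq> 0" "L y (Q j) \<noteq> 0" if "y \<in> opp ?x" for y
    using that L_P[of y i] L_Q[of y j] by (auto simp: opp_def)
  obtain c where c: "\<And>t. poly p t = c * (\<Prod>y\<in>insert ?x (opp ?x). \<alpha> y + t * \<beta> y)"
  proof (rule poly_multiple_of_linear_factors[of "insert ?x (opp ?x)" p \<beta> \<alpha>])
    show "degree p \<le> card (insert ?x (opp ?x))" using p(1) opp by (simp add: card_opp)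
    show "\<beta> y \<noteq> 0" if "y \<in> insert ?x (opp ?x)" for y
      using that opp_nz[of y] by (auto simp: \<beta>_def)
    show "\<alpha> y * \<beta> z \<noteq> \<alpha> z * \<beta> y"
      if yz: "y \<in> insert ?x (opp ?x)" "z \<in> insert ?x (opp ?x)" "y \<noteq> z" for y z
    proof -
      have "L y (P i) * L z (Q j) \<noteq> L z (P i) * L y (Q j)" if "y \<in> opp ?x" "z \<in> opp ?x"
      proof
        assume *: "L y (P i) * L z (Q j) = L z (P i) * L y (Q j)"
        let ?v = "L y (Q j) *s P i + (- L y (P i)) *s Q j"
        have "L y ?v = 0" "L z ?v = 0" using * by (simp_all only: L_linear) algebra+
        moreover have "?v \<noteq> 0"
        proof
          assume "?v = 0"
          then have "ccross ?v (Q j) = 0" by simp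
          then have "L y (Q j) *s ?n = 0" by (simp only: ccross_add_left ccross_scale_left) simp
          then show False using ccross_P_Q opp_nz(2)[of y] that by simp
        qed
        ultimately show False using double_points[OF that \<open>y \<noteq> z\<close>] L0 by blast
      qed
      then show ?thesis using yz opp_nz[of y] opp_nz[of z] opp
        by (cases "y = ?x"; cases "z = ?x") (simp_all add: \<alpha>_def \<beta>_def)
    qed
    show "poly p t = 0" if y: "y \<in> insert ?x (opp ?x)" and t: "\<alpha> y + t * \<beta> y = 0" for y t
    proof (cases "y = ?x")
      case True
      then show ?thesis using t FP p(2)[of 0] by (simp add: \<alpha>_def \<beta>_def)
    next
      case False
      then have "L y (P i + t *s Q j) = 0" using t by (simp add: \<alpha>_def \<beta>_def)
      then have "\<Omega> (P i + t *s Q j) = 0" using two[of ?x _ y] L0[of 1 t] False by simp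
      then show ?thesis by (simp add: p(2)[symmetric] F_def)
    qed
  qed (use opp in auto)
  have FPQ: "F (P i + t *s Q j) = t * (c * (\<Prod>y\<in>opp ?x. L y (P i + t *s Q j)))" for t
  proof -
    have "(\<Prod>y\<in>opp ?x. \<alpha> y + t * \<beta> y) = (\<Prod>y\<in>opp ?x. L y (P i + t *s Q j))"
      using opp(1) by (intro prod.cong) (auto simp: \<alpha>_def \<beta>_def)
    then show ?thesis using opp by (simp add: p(2) c \<alpha>_def \<beta>_def)
  qed
  have FQP: "F (Q j + t *s P i) = t * (c * (\<Prod>y\<in>opp ?x. L y (Q j + t *s P i)))" for t
  proof (cases "t = 0")
    case False
    have eq: "Q j + t *s P i = t *s (P i + inverse t *s Q j)"
      using False by (simp add: vec_eq_iff field_simps)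
    show ?thesis
      unfolding eq F_scale FPQ L_linear(2) prod.distrib prod_constant card_opp
      using False by (simp add: field_simps eval_nat_numeral)
  qed (simp add: FQ)
  show thesis
  proof (rule that[of c])
    fix t k
    show "eval (\<omega> k) (P i + t *s Q j)
       = t * (c * (\<Prod>y\<in>opp ?x. L y (P i + t *s Q j))) * ?n $ k"
      using on[of "P i + t *s Q j"] L0[of 1 t] FPQ[of t] by (simp add: \<Omega>_def vec_eq_iff)
    show "eval (\<omega> k) (Q j + t *s P i)
       = t * (c * (\<Prod>y\<in>opp ?x. L y (Q j + t *s P i))) * ?n $ k"
      using on[of "Q j + t *s P i"] L0[of t 1] FQP[of t] by (simp add: \<Omega>_def vec_eq_iff add.commute)
  qed
qed

lemma opp_simps:
  "(\<Prod>y\<in>opp (1, 1). f y) = f (2, 2) * f (2, 3) * f (3, 2) * f (3, 3)"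
  "(\<Prod>y\<in>opp (1, 2). f y) = f (2, 1) * f (2, 3) * f (3, 1) * f (3, 3)"
  "(\<Prod>y\<in>opp (2, 1). f y) = f (1, 2) * f (1, 3) * f (3, 2) * f (3, 3)"
  "(\<Prod>y\<in>opp (2, 2). f y) = f (1, 1) * f (1, 3) * f (3, 1) * f (3, 3)"
proof -
  have "- {1 :: 3} = {2, 3}" "- {2 :: 3} = {1, 3}"
    using exhaust_3 by auto
  then have o: "opp (1, 1) = {(2, 2), (2, 3), (3, 2), (3, 3)}" "opp (1, 2) = {(2, 1), (2, 3), (3, 1), (3, 3)}"
    "opp (2, 1) = {(1, 2), (1, 3), (3, 2), (3, 3)}" "opp (2, 2) = {(1, 1), (1, 3), (3, 1), (3, 3)}"
    unfolding opp_def by auto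
  show "(\<Prod>y\<in>opp (1, 1). f y) = f (2, 2) * f (2, 3) * f (3, 2) * f (3, 3)"
  "(\<Prod>y\<in>opp (1, 2). f y) = f (2, 1) * f (2, 3) * f (3, 1) * f (3, 3)"
  "(\<Prod>y\<in>opp (2, 1). f y) = f (1, 2) * f (1, 3) * f (3, 2) * f (3, 3)"
  "(\<Prod>y\<in>opp (2, 2). f y) = f (1, 1) * f (1, 3) * f (3, 1) * f (3, 3)"
    unfolding o by (simp_all add: mult.assoc)
qed

text \<open>
  Write \<open>N\<close> and \<open>D\<close> for the products at the \<open>P\<close> end and at the \<open>Q\<close> end of an edge. The
  assumptions make \<open>c i j * N i j\<close> depend on \<open>i\<close> only and \<open>c i j * D i j\<close> depend on \<open>j\<close> only, so
  the matrix of the quotients \<open>N i j / D i j\<close> has rank one. In its minor on the indices 1 and 2 most of the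
  brackets cancel, and what remains is the equation of the conic.
\<close>
lemma slopes_not_rank_one:
  assumes "\<And>i j. c i j \<noteq> 0"
    and P_slope: "\<And>i j k. c i j * (\<Prod>y\<in>opp (i, j). L y (P i)) = c i k * (\<Prod>y\<in>opp (i, k). L y (P i))"
    and Q_slope: "\<And>i j k. c i j * (\<Prod>y\<in>opp (i, j). L y (Q j)) = c k j * (\<Prod>y\<in>opp (k, j). L y (Q j))"
  shows False
proof -
  define N where "N i j = (\<Prod>y\<in>opp (i, j). L y (P i))" for i j
  define D where "D i j = (\<Prod>y\<in>opp (i, j). L y (Q j))" for i j
  have "(c 1 1 * N 1 1) * (c 2 2 * N 2 2) * (c 1 2 * D 1 2) * (c 2 1 * D 2 1)
      = (c 1 2 * N 1 2) * (c 2 1 * N 2 1) * (c 2 2 * D 2 2) * (c 1 1 * D 1 1)"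
    using P_slope[of 1 1 2] P_slope[of 2 2 1] Q_slope[of 1 2 2] Q_slope[of 2 1 1]
    by (simp add: N_def D_def)
  then have "(c 1 1 * c 2 2 * c 1 2 * c 2 1) * (N 1 1 * N 2 2 * D 1 2 * D 2 1)
    = (c 1 1 * c 2 2 * c 1 2 * c 2 1) * (N 1 2 * N 2 1 * D 2 2 * D 1 1)"
    by (simp only: mult_ac)
  then have ND: "N 1 1 * N 2 2 * D 1 2 * D 2 1 = N 1 2 * N 2 1 * D 2 2 * D 1 1"
    using assms(1) by simp
  define \<beta> where "\<beta> a b j = bracket (P b) (Q j) (P a)" for a b j
  define \<gamma> where "\<gamma> j k b = bracket (P b) (Q k) (Q j)" for j k b
  have LP: "L (b, j) (P a) = K b j * \<beta> a b j" and LQ: "L (b, k) (Q j) = K b k * \<gamma> j k b" for a b j k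
    by (simp_all add: \<beta>_def \<gamma>_def L_eq_bracket)
  have nz: "\<beta> a b j \<noteq> 0" if "a \<noteq> b" for a b j
    using L_P[of "(b, j)" a] that by (simp add: LP)
  have nz': "\<gamma> j k b \<noteq> 0" if "j \<noteq> k" for j k b
    using L_Q[of "(b, k)" j] that by (simp add: LQ)
  have swap: "\<beta> 2 1 j = - \<beta> 1 2 j" "\<gamma> 2 1 b = - \<gamma> 1 2 b" for j b
    by (simp_all add: \<beta>_def \<gamma>_def bracket_defs algebra_simps)
  \<comment> \<open>The factors common to both sides.\<close>
  define Z where "Z = (K 2 2 * K 2 3 * K 3 2 * K 3 3) * (K 1 1 * K 1 3 * K 3 1 * K 3 3)
     * (K 2 1 * K 2 3 * K 3 1 * K 3 3) * (K 1 2 * K 1 3 * K 3 2 * K 3 3)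
     * (\<beta> 1 2 3 * \<beta> 1 3 3 * \<beta> 2 1 3 * \<beta> 2 3 3 * \<gamma> 2 1 3 * \<gamma> 2 3 3 * \<gamma> 1 2 3 * \<gamma> 1 3 3)
     * (\<beta> 1 2 2 * \<beta> 1 2 1 * \<gamma> 1 2 2 * \<gamma> 1 2 1)"
  have "Z \<noteq> 0" unfolding Z_def using K nz nz' by simp
  moreover have "Z * (\<beta> 1 3 2 * \<beta> 2 3 1 * \<gamma> 2 3 2 * \<gamma> 1 3 1) = Z * (\<beta> 1 3 1 * \<beta> 2 3 2 * \<gamma> 2 3 1 * \<gamma> 1 3 2)"
    using ND unfolding N_def D_def opp_simps LP LQ swap Z_def by (simp add: mult_ac)
  ultimately have "\<beta> 1 3 2 * \<beta> 2 3 1 * \<gamma> 2 3 2 * \<gamma> 1 3 1 = \<beta> 1 3 1 * \<beta> 2 3 2 * \<gamma> 2 3 1 * \<gamma> 1 3 2"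
    by simp
  then show False
    using no_conic bracket_rotate[of "Q 3" "Q 1" "P 1"] bracket_rotate[of "Q 3" "Q 2" "P 2"]
      bracket_rotate[of "Q 3" "Q 2" "P 1"] bracket_rotate[of "Q 3" "Q 1" "P 2"]
    by (simp add: \<beta>_def \<gamma>_def mult_ac)
qed

text \<open>
  The factors \<open>c i j\<close> of the nine lines are linked at every vertex, so if one of them is nonzero
  then all are, which is impossible. So \<open>\<omega>\<close> vanishes on nine lines, and it has degree 6 only.
\<close>
lemma no_tangent_field:
  fixes \<omega> :: "3 \<Rightarrow> poly3"
  assumes hom: "\<And>k. \<omega> k \<in> homog 6"
    and tangent: "\<And>x v. L x v = 0 \<Longrightarrow> ccross (\<chi> k. eval (\<omega> k) v) (normal x) = 0"
  shows "eval (\<omega> k) v = 0"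
proof -
  have "\<forall>i j. \<exists>c. (\<forall>t k. eval (\<omega> k) (P i + t *s Q j)
       = t * (c * (\<Prod>y\<in>opp (i, j). L y (P i + t *s Q j))) * ccross (P i) (Q j) $ k) \<and>
    (\<forall>t k. eval (\<omega> k) (Q j + t *s P i)
       = t * (c * (\<Prod>y\<in>opp (i, j). L y (Q j + t *s P i))) * ccross (P i) (Q j) $ k)"
    using restriction_to_edge[OF assms] by metis
  then obtain c where
    cP: "\<And>i j t k. eval (\<omega> k) (P i + t *s Q j)
       = t * (c i j * (\<Prod>y\<in>opp (i, j). L y (P i + t *s Q j))) * ccross (P i) (Q j) $ k" and
    cQ: "\<And>i j t k. eval (\<omega> k) (Q j + t *s P i)
       = t * (c i j * (\<Prod>y\<in>opp (i, j). L y (Q j + t *s P i))) * ccross (P i) (Q j) $ k"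
    by metis
  have zero: "eval (\<omega> k) (P i) = 0" "eval (\<omega> k) (Q j) = 0" for i j k
    using cP[of k i 0] cQ[of k _ 0] by simp_all
  have nz: "(\<Prod>y\<in>opp (i, j). L y (P i)) \<noteq> 0" "(\<Prod>y\<in>opp (i, j). L y (Q j)) \<noteq> 0" for i j
    using L_P L_Q by (auto simp: opp_def prod_zero_iff)
  have P_slope: "c i a * (\<Prod>y\<in>opp (i, a). L y (P i)) = c i b * (\<Prod>y\<in>opp (i, b). L y (P i))" for i a b
  proof -
    have "\<forall>j. \<exists>p. \<forall>t. c i j * (\<Prod>y\<in>opp (i, j). L y (P i + t *s Q j)) = poly p t"
      by (intro allI cofactor_along_line)
    from choice[OF this] obtain g
      where g: "\<And>j t. c i j * (\<Prod>y\<in>opp (i, j). L y (P i + t *s Q j)) = poly (g j) t" by blast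
    have "poly (g a) 0 = poly (g b) 0"
    proof (rule vertex_slopes_equal[of \<omega> 6 "P i" Q])
      show "eval (\<omega> k) (P i + t *s Q j) = t * poly (g j) t * ccross (P i) (Q j) $ k" for j k t
        by (simp only: g[symmetric] cP)
    qed (fact hom zero QQP)+
    then show ?thesis using g[of a 0] g[of b 0] by simp
  qed
  have Q_slope: "c a j * (\<Prod>y\<in>opp (a, j). L y (Q j)) = c b j * (\<Prod>y\<in>opp (b, j). L y (Q j))" for j a b
  proof -
    have "\<forall>i. \<exists>p. \<forall>t. - c i j * (\<Prod>y\<in>opp (i, j). L y (Q j + t *s P i)) = poly p t"
      by (intro allI cofactor_along_line)
    from choice[OF this] obtain g
      where g: "\<And>i t. - c i j * (\<Prod>y\<in>opp (i, j). L y (Q j + t *s P i)) = poly (g i) t" by blast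
    have "poly (g a) 0 = poly (g b) 0"
    proof (rule vertex_slopes_equal[of \<omega> 6 "Q j" P])
      fix i k t
      show "eval (\<omega> k) (Q j + t *s P i) = t * poly (g i) t * ccross (Q j) (P i) $ k"
        unfolding g[symmetric] cQ ccross_minus_commute[of "Q j" "P i"] by simp
    qed (fact hom zero PPQ)+
    then have "- c a j * (\<Prod>y\<in>opp (a, j). L y (Q j)) = - c b j * (\<Prod>y\<in>opp (b, j). L y (Q j))"
      using g[of a 0] g[of b 0] by simp
    then show ?thesis by simp
  qed
  have "c i j = 0" for i j
  proof (rule ccontr)
    assume "c i j \<noteq> 0"
    then have "c i b \<noteq> 0" for b using P_slope[of i j b] nz by auto
    then have "c a b \<noteq> 0" for a b using Q_slope[of i b a] nz by auto
    then show False using slopes_not_rank_one P_slope Q_slope by blast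
  qed
  then have c0: "eval (\<omega> k) (P i + t *s Q j) = 0" for i j t k by (simp add: cP)
  show ?thesis
  proof (rule zero_on_all_lines[OF line_poly_eval[OF hom]])
    fix x v assume "L x v = 0"
    then obtain s t where v: "v = s *s P (fst x) + t *s Q (snd x)" by (rule on_line)
    show "eval (\<omega> k) v = 0"
    proof (cases "s = 0")
      case False
      then have "v = s *s (P (fst x) + (t / s) *s Q (snd x))" by (simp add: v vec_eq_iff field_simps)
      then show ?thesis by (simp only: eval_scale[OF hom] c0 mult_zero_right)
    qed (simp add: v eval_scale[OF hom] zero)
  qed simp
qed

end

section \<open>Linear relations between the nine lines\<close>

text \<open>
  The unknowns sit at the vertices and the equations on the edges of a 4-cycle.
\<close>
lemma four_cycle_solvable:
  fixes a b c d e f g h :: complex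
  assumes nz: "a \<noteq> 0" "b \<noteq> 0" "c \<noteq> 0" "d \<noteq> 0" "e \<noteq> 0" "f \<noteq> 0" "g \<noteq> 0" "h \<noteq> 0"
    and det: "a * d * f * g \<noteq> b * c * e * h"
  obtains s1 s2 t1 t2 where "s1 * a + t1 * e = p" "s1 * b + t2 * f = q" "s2 * c + t1 * g = r" "s2 * d + t2 * h = u"
proof -
  define \<Delta> where "\<Delta> = a * d * f * g - b * c * e * h"
  have \<Delta>: "\<Delta> \<noteq> 0" using det by (simp add: \<Delta>_def)
  define s1 where "s1 = (u * c * e * f - r * d * e * f + p * g * d * f - q * h * c * e) / \<Delta>"
  have s1: "s1 * \<Delta> = u * c * e * f - r * d * e * f + p * g * d * f - q * h * c * e"
    using \<Delta> by (simp add: s1_def)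
  define t1 where "t1 = (p - s1 * a) / e"
  define t2 where "t2 = (q - s1 * b) / f"
  define s2 where "s2 = (r - t1 * g) / c"
  have t1: "t1 * e = p - s1 * a" and t2: "t2 * f = q - s1 * b" and s2: "s2 * c = r - t1 * g"
    using nz by (simp_all add: t1_def t2_def s2_def)
  have "(s2 * d + t2 * h - u) * (c * e * f) = (s2 * c) * d * e * f + (t2 * f) * h * c * e - u * c * e * f"
    by (simp add: algebra_simps)
  also have "\<dots> = r * d * e * f - (t1 * e) * g * d * f + (q - s1 * b) * h * c * e - u * c * e * f"
    unfolding s2 t2 by (simp add: algebra_simps)
  also have "\<dots> = s1 * \<Delta> - (u * c * e * f - r * d * e * f + p * g * d * f - q * h * c * e)"
    unfolding t1 by (simp add: \<Delta>_def algebra_simps)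
  also have "\<dots> = 0" using s1 by simp
  finally have "s2 * d + t2 * h = u" using nz by simp
  then show thesis using t1 t2 s2 by (intro that[of s1 t1 t2 s2]) simp_all
qed

context bipartite_hexagon
begin

text \<open>
  The coefficients of the linear relation between the three lines through \<open>P i\<close>, as given by
  Cramer's rule for \<open>Q 1, Q 2, Q 3\<close> and \<open>P i\<close>.
\<close>
definition relP :: "3 \<Rightarrow> 3 \<Rightarrow> complex" where
  "relP i j = (if j = 1 then bracket (P i) (Q 2) (Q 3) else if j = 2 then bracket (Q 1) (P i) (Q 3)
     else bracket (Q 1) (Q 2) (P i)) / K i j"

definition relQ :: "3 \<Rightarrow> 3 \<Rightarrow> complex" where
  "relQ j i = (if i = 1 then bracket (Q j) (P 2) (P 3) else if i = 2 then bracket (P 1) (Q j) (P 3)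
     else bracket (P 1) (P 2) (Q j)) / K i j"

lemma relP_nonzero: "relP i j \<noteq> 0"
  using K QQP[of 1 2 i] QQP[of 1 3 i] QQP[of 2 3 i] bracket_rotate[of "Q 2" "Q 3" "P i"]
    bracket_swap23[of "Q 1" "P i" "Q 3"] by (simp add: relP_def)

lemma relQ_nonzero: "relQ j i \<noteq> 0"
  using K PPQ[of 1 2 j] PPQ[of 1 3 j] PPQ[of 2 3 j] bracket_rotate[of "P 2" "P 3" "Q j"]
    bracket_swap23[of "P 1" "Q j" "P 3"] by (simp add: relQ_def)

lemma relP_relation: "(\<Sum>j\<in>UNIV. relP i j *s normal (i, j)) = 0"
proof -
  have "ccross (P i) (bracket (P i) (Q 2) (Q 3) *s Q 1 + bracket (Q 1) (P i) (Q 3) *s Q 2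
      + bracket (Q 1) (Q 2) (P i) *s Q 3) = 0"
    unfolding cramer[symmetric] by (simp add: ccross_scale_right)
  then show ?thesis
    using K by (simp add: sum_3 relP_def normal_def ccross_add_right ccross_scale_right)
qed

lemma relQ_relation: "(\<Sum>i\<in>UNIV. relQ j i *s normal (i, j)) = 0"
proof -
  have "ccross (bracket (Q j) (P 2) (P 3) *s P 1 + bracket (P 1) (Q j) (P 3) *s P 2
      + bracket (P 1) (P 2) (Q j) *s P 3) (Q j) = 0"
    unfolding cramer[symmetric] by (simp add: ccross_scale_left)
  then show ?thesis
    using K by (simp add: sum_3 relQ_def normal_def ccross_add_left ccross_scale_left)
qed

text \<open>
  The brackets in the two products are, up to order and signs, those of \<open>no_conic\<close>.
\<close>
lemma cycle_det:
  "relP 1 1 * relP 2 2 * relQ 2 1 * relQ 1 2 \<noteq> relP 1 2 * relP 2 1 * relQ 1 1 * relQ 2 2"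
proof
  assume *: "relP 1 1 * relP 2 2 * relQ 2 1 * relQ 1 2 = relP 1 2 * relP 2 1 * relQ 1 1 * relQ 2 2"
  have **: "bracket (P 1) (Q 2) (Q 3) * bracket (Q 1) (P 2) (Q 3) * bracket (Q 2) (P 2) (P 3) * bracket (P 1) (Q 1) (P 3)
     = bracket (Q 1) (P 1) (Q 3) * bracket (P 2) (Q 2) (Q 3) * bracket (Q 1) (P 2) (P 3) * bracket (P 1) (Q 2) (P 3)"
    using * K by (simp add: relP_def relQ_def field_simps)
  have "bracket (P 1) (Q 2) (Q 3) = - bracket (Q 3) (Q 2) (P 1)" "bracket (Q 1) (P 2) (Q 3) = bracket (Q 3) (Q 1) (P 2)"
    "bracket (Q 2) (P 2) (P 3) = bracket (P 3) (Q 2) (P 2)" "bracket (P 1) (Q 1) (P 3) = - bracket (P 3) (Q 1) (P 1)"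
    "bracket (Q 1) (P 1) (Q 3) = bracket (Q 3) (Q 1) (P 1)" "bracket (P 2) (Q 2) (Q 3) = - bracket (Q 3) (Q 2) (P 2)"
    "bracket (Q 1) (P 2) (P 3) = bracket (P 3) (Q 1) (P 2)" "bracket (P 1) (Q 2) (P 3) = - bracket (P 3) (Q 2) (P 1)"
    by (simp_all add: bracket_defs algebra_simps)
  with ** no_conic show False by (simp add: mult_ac)
qed

text \<open>
  The last two lines meet only in \<open>P 3\<close>, which is not on the first.
\<close>
lemma normals_independent: "bracket (normal (2, 3)) (normal (3, 2)) (normal (3, 3)) \<noteq> 0"
proof
  assume "bracket (normal (2, 3)) (normal (3, 2)) (normal (3, 3)) = 0"
  then have "bracket (normal (3, 2)) (normal (3, 3)) (normal (2, 3)) = 0"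
    by (simp add: bracket_defs algebra_simps)
  then obtain s t where "normal (2, 3) = s *s normal (3, 2) + t *s normal (3, 3)"
    using plane_spanned[OF normal_indep[of "(3, 2)" "(3, 3)"]] by auto
  then have "L (2, 3) (P 3) = s * L (3, 2) (P 3) + t * L (3, 3) (P 3)"
    by (simp add: L_def cdot_def algebra_simps)
  also have "\<dots> = 0" using L_own_P[of "(3, 2)"] L_own_P[of "(3, 3)"] by simp
  finally show False using L_P[of "(2, 3)" 3] by simp
qed

lemma sum_lines: "(\<Sum>x\<in>UNIV. F x) = (\<Sum>i\<in>UNIV. \<Sum>j\<in>UNIV. F (i :: 3, j :: 3))"
  by (simp add: sum.cartesian_product)

text \<open>
  The four multipliers of the 4-cycle are determined by the coefficients on its edges, those of
  \<open>P 3\<close> and \<open>Q 3\<close> by the coefficients on \<open>(3, 1)\<close> and \<open>(1, 3)\<close>. What then remains is a relation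
  between three independent forms.
\<close>
lemma relations_spanned_by_vertices:
  assumes "(\<Sum>x\<in>UNIV. r x *s normal x) = 0"
  obtains s t where "\<And>i j. r (i, j) = s i * relP i j + t j * relQ j i"
proof -
  obtain s1 s2 t1 t2 where four: "s1 * relP 1 1 + t1 * relQ 1 1 = r (1, 1)"
    "s1 * relP 1 2 + t2 * relQ 2 1 = r (1, 2)" "s2 * relP 2 1 + t1 * relQ 1 2 = r (2, 1)"
    "s2 * relP 2 2 + t2 * relQ 2 2 = r (2, 2)"
    by (rule four_cycle_solvable[of "relP 1 1" "relP 1 2" "relP 2 1" "relP 2 2"
        "relQ 1 1" "relQ 2 1" "relQ 1 2" "relQ 2 2"])
      (use relP_nonzero relQ_nonzero cycle_det in auto)
  define s where "s i = (if i = 1 then s1 else if i = 2 then s2 else (r (3, 1) - t1 * relQ 1 3) / relP 3 1)" for i :: 3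
  define t where "t j = (if j = 1 then t1 else if j = 2 then t2 else (r (1, 3) - s1 * relP 1 3) / relQ 3 1)" for j :: 3
  define d where "d x = r x - s (fst x) * relP (fst x) (snd x) - t (snd x) * relQ (snd x) (fst x)" for x
  have d0: "d (1, 1) = 0" "d (1, 2) = 0" "d (2, 1) = 0" "d (2, 2) = 0" "d (3, 1) = 0" "d (1, 3) = 0"
    using four relP_nonzero[of 3 1] relQ_nonzero[of 3 1]
    by (auto simp: d_def s_def t_def field_simps)
  have dr: "(\<Sum>x\<in>UNIV. d x *s normal x) = 0"
  proof -
    have "(\<Sum>x\<in>UNIV. d x *s normal x) = (\<Sum>x\<in>UNIV. r x *s normal x)
       - (\<Sum>x\<in>UNIV. (s (fst x) * relP (fst x) (snd x)) *s normal x)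
       - (\<Sum>x\<in>UNIV. (t (snd x) * relQ (snd x) (fst x)) *s normal x)"
      by (simp add: d_def vec_eq_iff sum_subtractf left_diff_distrib)
    also have "(\<Sum>x\<in>UNIV. (s (fst x) * relP (fst x) (snd x)) *s normal x)
        = (\<Sum>i\<in>UNIV. s i *s (\<Sum>j\<in>UNIV. relP i j *s normal (i, j)))"
      by (simp add: sum_lines vec_eq_iff sum_distrib_left mult.assoc)
    also have "(\<Sum>x\<in>UNIV. (t (snd x) * relQ (snd x) (fst x)) *s normal x)
        = (\<Sum>j\<in>UNIV. t j *s (\<Sum>i\<in>UNIV. relQ j i *s normal (i, j)))"
      by (subst sum_lines, subst sum.swap) (simp add: vec_eq_iff sum_distrib_left mult.assoc)
    finally show ?thesis using assms by (simp add: relP_relation relQ_relation)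
  qed
  then have comb: "d (2, 3) *s normal (2, 3) + (d (3, 2) *s normal (3, 2) + d (3, 3) *s normal (3, 3)) = 0"
    by (simp add: sum_lines sum_3 d0)
  have c: "d (2, 3) * cdot w (normal (2, 3)) + (d (3, 2) * cdot w (normal (3, 2)) + d (3, 3) * cdot w (normal (3, 3))) = 0" for w
    using arg_cong[OF comb, of "cdot w"] by simp
  have "d (2, 3) * bracket (normal (2, 3)) (normal (3, 2)) (normal (3, 3)) = 0"
    using c[of "ccross (normal (3, 2)) (normal (3, 3))"]
    by (simp add: bracket_def[symmetric] bracket_rotate[of "normal (3, 2)"])
  moreover have "d (3, 2) * bracket (normal (2, 3)) (normal (3, 2)) (normal (3, 3)) = 0"
    using c[of "ccross (normal (3, 3)) (normal (2, 3))"]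
    by (simp add: bracket_def[symmetric] bracket_rotate[of "normal (3, 3)"] bracket_rotate[of "normal (3, 2)"])
  moreover have "d (3, 3) * bracket (normal (2, 3)) (normal (3, 2)) (normal (3, 3)) = 0"
    using c[of "ccross (normal (2, 3)) (normal (3, 2))"]
    by (simp add: bracket_def[symmetric])
  ultimately have "d (2, 3) = 0" "d (3, 2) = 0" "d (3, 3) = 0" using normals_independent by auto
  with d0 have "\<forall>i j. d (i, j) = 0" by (simp add: forall_3)
  then show thesis by (intro that[of s t]) (simp add: d_def algebra_simps)
qed

text \<open>
  Choose \<open>w\<close> with the right values on the three independent forms. The differences \<open>d\<close> satisfy the
  relation at each vertex; the relations at \<open>P 3\<close> and \<open>Q 3\<close> leave only the 4-cycle on
  \<open>P 1, P 2, Q 1, Q 2\<close>, and going round it once multiplies \<open>d (1, 1)\<close> by a factor different from 1.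
\<close>
lemma values_given_at_vertices:
  assumes P_val: "\<And>i. \<exists>w. \<forall>j. c (i, j) = L (i, j) w"
    and Q_val: "\<And>j. \<exists>w. \<forall>i. c (i, j) = L (i, j) w"
  obtains w where "\<And>x. c x = L x w"
proof -
  let ?l = "normal (2, 3)" and ?m = "normal (3, 2)" and ?n = "normal (3, 3)"
  \<comment> \<open>The cross products form the dual basis of the three normals, up to the common factor.\<close>
  define w where "w = inverse (bracket ?l ?m ?n) *s (c (2, 3) *s ccross ?m ?n
     + c (3, 2) *s ccross ?n ?l + c (3, 3) *s ccross ?l ?m)"
  have "L (2, 3) w = c (2, 3)" "L (3, 2) w = c (3, 2)" "L (3, 3) w = c (3, 3)"
  proof -
    have "cdot ?l (ccross ?m ?n) = bracket ?l ?m ?n" "cdot ?m (ccross ?n ?l) = bracket ?l ?m ?n"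
      "cdot ?n (ccross ?l ?m) = bracket ?l ?m ?n"
      by (simp_all add: bracket_def cdot_def algebra_simps)
    moreover have "cdot v (ccross v u) = 0" "cdot v (ccross u v) = 0" for u v
      by (simp_all add: cdot_def algebra_simps)
    ultimately show "L (2, 3) w = c (2, 3)" "L (3, 2) w = c (3, 2)" "L (3, 3) w = c (3, 3)"
      using normals_independent by (simp_all add: L_def w_def)
  qed
  define d where "d x = c x - L x w" for x
  have d0: "d (2, 3) = 0" "d (3, 2) = 0" "d (3, 3) = 0"
    using \<open>L (2, 3) w = c (2, 3)\<close> \<open>L (3, 2) w = c (3, 2)\<close> \<open>L (3, 3) w = c (3, 3)\<close> by (simp_all add: d_def)
  have L_diff: "L x u - L x w = L x (u - w)" for x u by (simp add: L_def)
  have relP: "relP i 1 * d (i, 1) + relP i 2 * d (i, 2) + relP i 3 * d (i, 3) = 0" for i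
  proof -
    obtain u where u: "\<And>j. d (i, j) = L (i, j) (u - w)" using P_val[of i] L_diff by (metis d_def)
    show ?thesis
      using arg_cong[OF relP_relation[of i], of "\<lambda>n. cdot n (u - w)"]
      by (simp add: u L_def sum_3 cdot_add_left del: cdot_diff_right)
  qed
  have relQ: "relQ j 1 * d (1, j) + relQ j 2 * d (2, j) + relQ j 3 * d (3, j) = 0" for j
  proof -
    obtain u where u: "\<And>i. d (i, j) = L (i, j) (u - w)" using Q_val[of j] L_diff by (metis d_def)
    show ?thesis
      using arg_cong[OF relQ_relation[of j], of "\<lambda>n. cdot n (u - w)"]
      by (simp add: u L_def sum_3 cdot_add_left del: cdot_diff_right)
  qed
  have d1: "d (3, 1) = 0" "d (1, 3) = 0"
    using relP[of 3] relQ[of 3] d0 relP_nonzero relQ_nonzero by auto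
  have e: "relP 1 1 * d (1, 1) = - (relP 1 2 * d (1, 2))" "relP 2 2 * d (2, 2) = - (relP 2 1 * d (2, 1))"
    "relQ 1 2 * d (2, 1) = - (relQ 1 1 * d (1, 1))" "relQ 2 1 * d (1, 2) = - (relQ 2 2 * d (2, 2))"
    using relP[of 1] relP[of 2] relQ[of 1] relQ[of 2] d0 d1
    by (simp_all add: eq_neg_iff_add_eq_0 add.commute)
  have "relP 1 1 * relP 2 2 * relQ 2 1 * relQ 1 2 * d (1, 1)
     = (relP 1 1 * d (1, 1)) * relP 2 2 * relQ 2 1 * relQ 1 2" by (simp add: mult_ac)
  also have "\<dots> = - (relP 1 2 * (relQ 2 1 * d (1, 2)) * relP 2 2 * relQ 1 2)" unfolding e(1) by (simp add: mult_ac)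
  also have "\<dots> = relP 1 2 * relQ 2 2 * (relP 2 2 * d (2, 2)) * relQ 1 2" unfolding e(4) by (simp add: mult_ac)
  also have "\<dots> = - (relP 1 2 * relQ 2 2 * relP 2 1 * (relQ 1 2 * d (2, 1)))" unfolding e(2) by (simp add: mult_ac)
  also have "\<dots> = relP 1 2 * relP 2 1 * relQ 1 1 * relQ 2 2 * d (1, 1)" unfolding e(3) by (simp add: mult_ac)
  finally have d2: "d (1, 1) = 0" using cycle_det by simp
  then have d3: "d (1, 2) = 0" "d (2, 1) = 0" using e(1,3) relP_nonzero relQ_nonzero by auto
  then have "d (2, 2) = 0" using e(2) relP_nonzero by auto
  with d0 d1 d2 d3 have "\<forall>i j. d (i, j) = 0" by (simp add: forall_3)
  then show thesis by (intro that[of w]) (simp add: d_def split_paired_all)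
qed

section \<open>The equation of the arrangement\<close>

definition cof :: "3 \<times> 3 \<Rightarrow> poly3" where
  "cof x = (\<Prod>y\<in>- {x}. linform (normal y))"

definition f :: poly3 where
  "f = (\<Prod>x\<in>UNIV. linform (normal x))"

lemma f_eq: "f = linform (normal x) * cof x"
  unfolding f_def cof_def by (subst prod.remove[of UNIV x]) (auto simp: Compl_eq_Diff_UNIV)

lemma eval_f: "eval f v = (\<Prod>x\<in>UNIV. L x v)"
  by (simp add: f_def eval_prod L_def)

lemma eval_cof: "eval (cof x) v = (\<Prod>y\<in>- {x}. L y v)"
  by (simp add: cof_def eval_prod L_def)

lemma homog_f: "f \<in> homog 9"
  using homog_prod[of UNIV "\<lambda>x. linform (normal x)", OF homog_linform] by (simp add: f_def)

lemma homog_cof: "cof x \<in> homog 8"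
  using homog_prod[of "- {x}" "\<lambda>x. linform (normal x)", OF homog_linform]
  by (simp add: cof_def Compl_eq_Diff_UNIV card_Diff_singleton)

lemma eval_cof_nonzero: "(\<And>y. y \<noteq> x \<Longrightarrow> L y v \<noteq> 0) \<Longrightarrow> eval (cof x) v \<noteq> 0"
  by (simp add: eval_cof prod_zero_iff)

text \<open>
  By the product rule, all terms but one contain the factor \<open>L x v = 0\<close>.
\<close>
lemma dir_deriv_f: "L x v = 0 \<Longrightarrow> dir_deriv f v w = L x w * eval (cof x) v"
  by (subst f_eq[of x]) (simp add: dir_deriv_mult L_def)

lemma eval_combination:
  "eval (\<Sum>k\<in>UNIV. r k * partial k f) v = dir_deriv f v (\<chi> k. eval (r k) v)"
  by (simp add: eval_sum dir_deriv_def)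

lemma line_poly_field: "\<exists>d. line_poly d (\<lambda>v. L x (\<chi> k. eval (r k) v))"
proof -
  have "eval (linform (normal x)) (\<chi> k. eval (r k) v) = eval (\<Sum>k\<in>UNIV. const (normal x $ k) * r k) v" for v
    by (simp add: eval_sum sum_3 cdot_def)
  then have "(\<lambda>v. L x (\<chi> k. eval (r k) v)) = eval (\<Sum>k\<in>UNIV. const (normal x $ k) * r k)"
    by (simp add: L_def fun_eq_iff)
  then show ?thesis by (simp only: line_poly_eval_ex)
qed

section \<open>Syzygies\<close>

lemma syzygy_tangent:
  assumes syz: "(\<Sum>k\<in>UNIV. r k * partial k f) = 0" and u: "L x u = 0"
  shows "L x (\<chi> k. eval (r k) u) = 0"
proof -
  obtain v where v: "L x v = 0" "\<And>y. y \<noteq> x \<Longrightarrow> L y v \<noteq> 0" using exists_off_other_lines[of x] by blast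
  obtain d where d: "line_poly d (\<lambda>v. L x (\<chi> k. eval (r k) v))" using line_poly_field by blast
  show ?thesis
  proof (rule line_poly_cancel_on_plane[OF d line_poly_eval[OF homog_cof[of x]], of "normal x" v])
    fix w assume w: "cdot (normal x) w = 0"
    show "L x (\<chi> k. eval (r k) w) * eval (cof x) w = 0"
      using eval_combination[of r w] dir_deriv_f[of x w] w syz by (simp add: L_def)
  qed (use v u eval_cof_nonzero in \<open>auto simp: L_def\<close>)
qed

text \<open>
  With \<open>\<theta>\<close> tangent to every line, \<open>\<theta>(v) \<times> v\<close> is normal to the plane of the line at each of its
  points, so it vanishes by \<open>no_tangent_field\<close>. Then \<open>\<theta>(v) = h v\<close>, and Euler's identity turns
  \<open>\<theta>(f) = 0\<close> into \<open>9 h f = 0\<close>.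
\<close>
lemma no_syzygy_degree_5:
  assumes syz: "(\<Sum>k\<in>UNIV. r k * partial k f) = 0" and hom: "\<And>k. r k \<in> homog 5"
  shows "r k = 0"
proof -
  define \<theta> where "\<theta> v = (\<chi> k. eval (r k) v)" for v
  define \<omega> where "\<omega> k = (if k = 1 then r 2 * var 3 - r 3 * var 2 else if k = 2 then r 3 * var 1 - r 1 * var 3
     else r 1 * var 2 - r 2 * var 1)" for k :: 3
  have \<omega>_eval: "(\<chi> k. eval (\<omega> k) v) = ccross (\<theta> v) v" for v
    by (simp add: vec3_eq_iff \<omega>_def \<theta>_def)
  have "r i * var j \<in> homog 6" for i j using homog_mult[OF hom homog_var] by simp
  then have \<omega>_hom: "\<omega> k \<in> homog 6" for k unfolding \<omega>_def by (auto intro!: homog_diff)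
  have "eval (\<omega> k) v = 0" for k v
  proof (rule no_tangent_field[OF \<omega>_hom])
    fix x v assume x: "L x v = 0"
    have "L x (\<theta> v) = 0" using syzygy_tangent[OF syz x] by (simp add: \<theta>_def)
    then have "ccross (normal x) (ccross (\<theta> v) v) = 0" using x by (simp add: ccross_ccross L_def)
    then show "ccross (\<chi> k. eval (\<omega> k) v) (normal x) = 0"
      unfolding \<omega>_eval using ccross_minus_commute[of "ccross (\<theta> v) v" "normal x"] by simp
  qed
  then have parallel: "ccross (\<theta> v) v = 0" for v using \<omega>_eval[of v] by (simp add: vec_eq_iff)
  have "eval (r k) v = 0" for v
  proof (rule line_poly_zero_off_planes[OF line_poly_eval[OF hom], of "range normal"])
    fix v assume "\<And>n. n \<in> range normal \<Longrightarrow> cdot n v \<noteq> 0"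
    then have Lv: "L x v \<noteq> 0" for x by (simp add: L_def)
    then have "v \<noteq> 0" by force
    then obtain h where h: "\<theta> v = h *s v"
      using ccross_eq_0D[of v "\<theta> v"] parallel[of v] ccross_minus_commute[of v "\<theta> v"] by auto
    have "dir_deriv f v (\<theta> v) = 0"
      using eval_combination[of r v] syz by (simp add: \<theta>_def)
    then have "h * (9 * eval f v) = 0"
      using dir_deriv_self[OF homog_f, of v] by (simp add: h dir_deriv_scale_right)
    moreover have "eval f v \<noteq> 0" using Lv by (simp add: eval_f)
    ultimately have "h = 0" by simp
    then show "eval (r k) v = 0" using h by (simp add: \<theta>_def vec_eq_iff)
  qed (use normal_nonzero in \<open>auto simp: image_iff\<close>)
  then show ?thesis by (intro poly3_eqI) simp
qed

text \<open>
  Multiplication by a power of a variable raises the degree to 5.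
\<close>
lemma no_syzygy_below_6:
  assumes syz: "(\<Sum>k\<in>UNIV. r k * partial k f) = 0" and hom: "\<And>k. r k \<in> homog d" and d: "d < 6"
  shows "r k = 0"
proof -
  have pow: "var 1 ^ n \<in> homog n" for n
  proof (induction n)
    case (Suc n)
    then show ?case using homog_mult[OF homog_var Suc, of 1] by simp
  qed simp
  define q where "q = var 1 ^ (5 - d)"
  have "q * r k = 0"
  proof (rule no_syzygy_degree_5[of "\<lambda>k. q * r k"])
    show "(\<Sum>k\<in>UNIV. q * r k * partial k f) = 0"
      using syz by (simp add: mult.assoc sum_distrib_left[symmetric])
    show "q * r k \<in> homog 5" for k
      using homog_mult[OF pow[of "5 - d"] hom[of k]] d by (simp add: q_def)
  qed
  have "eval (r k) v = 0" for v
  proof (rule line_poly_zero_off_planes[OF line_poly_eval[OF hom], of "{axis 1 1}"])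
    fix v assume "\<And>n. n \<in> {axis 1 1} \<Longrightarrow> cdot n v \<noteq> 0"
    then have "v $ 1 \<noteq> 0" by (simp add: cdot_def axis_def)
    then show "eval (r k) v = 0" using arg_cong[OF \<open>q * r k = 0\<close>, of "\<lambda>p. eval p v"] by (simp add: q_def)
  qed (auto simp: vec_eq_iff axis_def)
  then show ?thesis by (intro poly3_eqI) simp
qed

text \<open>
  Let \<open>v = P 1\<close>, and split \<open>f = g h\<close> into the lines through \<open>v\<close> and the six others. The derivative
  \<open>\<partial>\<^sub>v\<close> kills \<open>g\<close>, so \<open>h \<partial>\<^sub>v f = (\<partial>\<^sub>v h) f\<close>, which Euler's identity rewrites as a multiple of the
  Euler field applied to \<open>f\<close>. At the point \<open>v\<close> the difference of the two fields is
  \<open>h(v) (1 - 6/9) v\<close>, which is not zero.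
\<close>
lemma syzygy_of_degree_6:
  obtains r j where "(\<Sum>k\<in>UNIV. r k * partial k f) = 0" "\<And>k. r k \<in> homog 6" "r j \<noteq> 0"
proof -
  let ?far = "{x :: 3 \<times> 3. fst x \<noteq> 1}" and ?near = "{x :: 3 \<times> 3. fst x = 1}"
  define h where "h = (\<Prod>x\<in>?far. linform (normal x))"
  define g where "g = (\<Prod>x\<in>?near. linform (normal x))"
  define v where "v = P 1"
  have "f = g * h"
    unfolding f_def g_def h_def
    by (subst prod.union_disjoint[symmetric]) (auto intro!: prod.cong)
  have far: "?far = (- {1}) \<times> UNIV" by auto
  have hom: "h \<in> homog 6"
    using homog_prod[of ?far "\<lambda>x. linform (normal x)", OF homog_linform]
    by (simp add: h_def far card_cartesian_product Compl_eq_Diff_UNIV card_Diff_singleton)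
  define h' where "h' = (\<Sum>k\<in>UNIV. const (v $ k) * partial k h)"
  have h': "eval h' u = dir_deriv h u v" for u
    by (simp add: h'_def eval_sum dir_deriv_def)
  have hom': "h' \<in> homog 5"
    unfolding h'_def using homog_partial[of h 5] hom by auto
  define r where "r k = const (v $ k) * h - const (1 / 9) * (h' * var k)" for k
  have "h' * var k \<in> homog 6" for k using homog_mult[OF hom' homog_var] by simp
  then have r_hom: "r k \<in> homog 6" for k
    unfolding r_def using hom by (intro homog_diff homog_const_mult)
  have r_eval: "(\<chi> k. eval (r k) u) = eval h u *s v + (- dir_deriv h u v / 9) *s u" for u
    by (simp add: r_def vec_eq_iff h')
  have "(\<Sum>k\<in>UNIV. r k * partial k f) = 0"
  proof (rule poly3_eqI)
    fix u
    have "L x v = 0" if "fst x = 1" for x using L_own_P[of x] that by (simp add: v_def)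
    then have "eval g (u + t *s v) = eval g u" for t
      unfolding g_def eval_prod by (intro prod.cong) (auto simp: L_def)
    then have "dir_deriv g u v = 0" by (rule dir_deriv_constant)
    then have "dir_deriv f u v = eval g u * dir_deriv h u v"
      by (simp add: \<open>f = g * h\<close> dir_deriv_mult)
    moreover have "dir_deriv f u u = 9 * (eval g u * eval h u)"
      using dir_deriv_self[OF homog_f, of u] by (simp add: \<open>f = g * h\<close>)
    ultimately show "eval (\<Sum>k\<in>UNIV. r k * partial k f) u = eval 0 u"
      unfolding eval_combination r_eval dir_deriv_add_right dir_deriv_scale_right by simp
  qed
  moreover have "\<exists>k. r k \<noteq> 0"
  proof (rule ccontr)
    assume "\<nexists>k. r k \<noteq> 0"
    then have "eval h v *s v + (- dir_deriv h v v / 9) *s v = 0"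
      using r_eval[of v] by (simp add: vec_eq_iff)
    then have "(eval h v / 3) *s v = 0"
      using dir_deriv_self[OF hom, of v] by (simp add: vec_eq_iff field_simps)
    moreover have "eval h v \<noteq> 0"
      using L_P[of _ 1] by (simp add: h_def eval_prod prod_zero_iff v_def L_def)
    moreover have "v \<noteq> 0" unfolding v_def using ccross_P_Q[of 1 1] by auto
    ultimately show False by simp
  qed
  ultimately show thesis using that r_hom by blast
qed

section \<open>Saturation in degree 8\<close>

text \<open>
  Take a basis \<open>U, V\<close> of the plane of the line \<open>x\<close>, with \<open>V\<close> on no other line, and a linear form \<open>e\<close>
  with values 1 and 0 on it. In the chart \<open>U + t V\<close> the power of \<open>e\<close> is 1, so \<open>g\<close> is a polynomial
  multiple of the cofactor of \<open>x\<close>. The latter has degree exactly 8 in \<open>t\<close>, so the multiplier is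
  constant.
\<close>
lemma proportional_to_cofactor:
  assumes g: "g \<in> homog 8"
    and sat: "\<And>e. \<exists>r. linform e ^ n * g = (\<Sum>k\<in>UNIV. r k * partial k f)"
  obtains c where "\<And>u. L x u = 0 \<Longrightarrow> eval g u = c * eval (cof x) u"
proof -
  obtain V where V: "L x V = 0" "\<And>y. y \<noteq> x \<Longrightarrow> L y V \<noteq> 0" using exists_off_other_lines[of x] by blast
  have V0: "V \<noteq> 0"
  proof
    assume "V = 0"
    moreover obtain y where "y \<noteq> x" using normals_independent by (metis bracket_repeat(1) bracket_repeat(3))
    ultimately show False using V(2)[of y] by simp
  qed
  obtain U where U: "L x U = 0" "ccross U V \<noteq> 0"
  proof (cases "ccross (P (fst x)) V = 0 \<and> ccross (Q (snd x)) V = 0")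
    case True
    then have "V = 0"
      using eq_0_of_parallel_to_two[of V "P (fst x)" "Q (snd x)"] ccross_P_Q
        ccross_minus_commute[of V] by simp
    with V0 show thesis by simp
  qed (use that[of "P (fst x)"] that[of "Q (snd x)"] in auto)
  obtain z where z: "cdot (ccross U V) z = 1" using exists_cdot_eq_1[OF U(2)] .
  define e where "e = ccross V z"
  have e: "cdot e U = 1" "cdot e V = 0"
    using z bracket_rotate[of V z U] by (simp_all add: e_def bracket_def)
  obtain r where r: "linform e ^ n * g = (\<Sum>k\<in>UNIV. r k * partial k f)" using sat by blast
  have plane: "L x (a *s U + b *s V) = 0" for a b using U V by simp
  obtain d where d: "line_poly d (\<lambda>v. L x (\<chi> k. eval (r k) v))" using line_poly_field by blast
  obtain pr where pr: "\<And>t. L x (\<chi> k. eval (r k) (U + t *s V)) = poly pr t"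
    by (rule line_polyE[OF d, of U V]) blast
  obtain pg where pg: "degree pg \<le> 8" "\<And>t. eval g (U + t *s V) = poly pg t"
    by (rule line_polyE[OF line_poly_eval[OF g], of U V]) blast
  define pc where "pc = (\<Prod>y\<in>- {x}. [:L y U, L y V:])"
  have pc: "poly pc t = eval (cof x) (U + t *s V)" for t
    by (simp add: pc_def poly_prod eval_cof)
  have deg: "degree pc = 8"
    unfolding pc_def using V(2)
    by (subst degree_prod_eq_sum_degree) (auto simp: Compl_eq_Diff_UNIV card_Diff_singleton)
  have "poly pg t = poly (pr * pc) t" for t
  proof -
    have "eval g (U + t *s V) = eval (linform e ^ n * g) (U + t *s V)" by (simp add: e)
    also have "\<dots> = L x (\<chi> k. eval (r k) (U + t *s V)) * eval (cof x) (U + t *s V)"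
      unfolding r eval_combination using plane[of 1 t] by (intro dir_deriv_f) simp
    finally show ?thesis by (simp add: pg pr pc)
  qed
  then have "pg = pr * pc" by (simp add: poly_eq_poly_eq_iff[symmetric] fun_eq_iff)
  moreover have "pc \<noteq> 0" using deg by auto
  ultimately have "degree pr = 0"
    using pg(1) deg by (cases "pr = 0") (auto simp: degree_mult_eq)
  then obtain c where "pr = [:c:]" by (rule degree_eq_zeroE)
  then have c: "eval g (U + t *s V) = c * eval (cof x) (U + t *s V)" for t
    using \<open>pg = pr * pc\<close> by (simp add: pg pc[symmetric])
  show thesis
  proof (rule that[of c])
    fix u assume u: "L x u = 0"
    have "line_poly 8 (\<lambda>u. eval g u - c * eval (cof x) u)"
      by (intro line_poly_diff line_poly_cmult line_poly_eval g homog_cof)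
    then have "eval g u - c * eval (cof x) u = 0"
    proof (rule line_poly_cancel_on_plane[OF _ line_poly_cdot[of e], where n = "normal x" and v = U])
      fix w assume w: "cdot (normal x) w = 0"
      show "(eval g w - c * eval (cof x) w) * cdot e w = 0"
      proof (cases "cdot e w = 0")
        case False
        have "bracket U V w = 0"
        proof -
          obtain k where "normal x = k *s ccross U V"
            using normal_of_plane[OF U(2), of "normal x"] U(1) V(1) by (auto simp: L_def)
          moreover from this have "k \<noteq> 0" using normal_nonzero[of x] by auto
          ultimately show ?thesis using w by (simp add: bracket_def)
        qed
        then obtain a b where "w = a *s U + b *s V" using plane_spanned[OF U(2)] by blast
        moreover from this have "a \<noteq> 0" using False e by auto
        ultimately have "w = a *s (U + (b / a) *s V)" by (simp add: vec_eq_iff field_simps)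
        then show ?thesis
          using c[of "b / a"] by (simp only: eval_scale[OF g] eval_scale[OF homog_cof]) simp
      qed simp
    qed (use u U e in \<open>auto simp: L_def\<close>)
    then show "eval g u = c * eval (cof x) u" by simp
  qed
qed

text \<open>
  On the line \<open>x\<close> the hypothesis reads \<open>e\<^sup>n c (f/\<ell>) = \<ell>(r) (f/\<ell>)\<close>; cancel and evaluate at \<open>V\<close>.
  The vector at which \<open>L x\<close> is evaluated on the right is the same for all lines \<open>x\<close> through \<open>V\<close>.
\<close>
lemma cofactors_at_vertex:
  assumes r: "linform e ^ n * g = (\<Sum>k\<in>UNIV. r k * partial k f)" and e: "cdot e V = 1"
    and c: "\<And>u. L x u = 0 \<Longrightarrow> eval g u = c * eval (cof x) u" and V: "L x V = 0"
  shows "c = L x (\<chi> k. eval (r k) V)"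
proof -
  obtain v where v: "L x v = 0" "\<And>y. y \<noteq> x \<Longrightarrow> L y v \<noteq> 0" using exists_off_other_lines[of x] by blast
  define F where "F u = c * eval (linform e ^ n) u - L x (\<chi> k. eval (r k) u)" for u
  obtain d where d: "line_poly d (\<lambda>v. L x (\<chi> k. eval (r k) v))" using line_poly_field by blast
  obtain d' where d': "line_poly d' (eval (linform e ^ n))" using line_poly_eval_ex by blast
  have "line_poly (max d d') F"
    unfolding F_def[abs_def] by (intro line_poly_diff line_poly_cmult line_poly_mono[OF d] line_poly_mono[OF d']) auto
  then have "F V = 0"
  proof (rule line_poly_cancel_on_plane[OF _ line_poly_eval[OF homog_cof[of x]], where n = "normal x" and v = v])
    fix w assume "cdot (normal x) w = 0"
    then have w: "L x w = 0" by (simp add: L_def)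
    have "eval (linform e ^ n * g) w = L x (\<chi> k. eval (r k) w) * eval (cof x) w"
      unfolding r eval_combination by (rule dir_deriv_f[OF w])
    then show "F w * eval (cof x) w = 0" by (simp add: F_def c[OF w] algebra_simps)
  qed (use v V eval_cof_nonzero in \<open>auto simp: L_def\<close>)
  then show ?thesis by (simp add: F_def e)
qed

text \<open>
  The factors \<open>c x\<close> of the nine lines come at each vertex from a vector, hence from one vector \<open>w\<close>.
  The derivative of \<open>f\<close> in direction \<open>w\<close> restricts to each line in the same way as \<open>g\<close>.
\<close>
lemma saturated_degree_8:
  assumes g: "g \<in> homog 8"
    and sat: "\<And>e. \<exists>r. linform e ^ n * g = (\<Sum>k\<in>UNIV. r k * partial k f)"
  obtains w where "g = (\<Sum>k\<in>UNIV. const (w $ k) * partial k f)"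
proof -
  have "\<forall>x. \<exists>c. \<forall>u. L x u = 0 \<longrightarrow> eval g u = c * eval (cof x) u"
    using proportional_to_cofactor[OF assms] by metis
  from choice[OF this] obtain c where c: "\<And>x u. L x u = 0 \<Longrightarrow> eval g u = c x * eval (cof x) u" by blast
  have vertex: "\<exists>w. \<forall>x. L x V = 0 \<longrightarrow> c x = L x w" if V: "V \<noteq> 0" for V
  proof -
    obtain e where "cdot V e = 1" using exists_cdot_eq_1[OF V] .
    then have e: "cdot e V = 1" by (simp add: cdot_commute)
    from sat[of e] obtain r where "linform e ^ n * g = (\<Sum>k\<in>UNIV. r k * partial k f)" by blast
    from cofactors_at_vertex[OF this e] c show ?thesis by blast
  qed
  have nz: "P i \<noteq> 0" "Q j \<noteq> 0" for i j using ccross_P_Q[of i j] by auto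
  obtain w where w: "\<And>x. c x = L x w"
  proof (rule values_given_at_vertices[of c])
    show "\<exists>w. \<forall>j. c (i, j) = L (i, j) w" for i
      using vertex[OF nz(1)[of i]] L_own_P[of "(i, _)"] by (metis fst_conv)
    show "\<exists>w. \<forall>i. c (i, j) = L (i, j) w" for j
      using vertex[OF nz(2)[of j]] L_own_Q[of "(_, j)"] by (metis snd_conv)
  qed blast
  let ?g' = "\<Sum>k\<in>UNIV. const (w $ k) * partial k f"
  have g': "eval ?g' u = dir_deriv f u w" for u by (simp add: eval_sum dir_deriv_def)
  have hom': "?g' \<in> homog 8" using homog_partial[of f 8] homog_f by auto
  have "eval (g - ?g') v = 0" for v
  proof (rule zero_on_all_lines[OF line_poly_eval])
    show "g - ?g' \<in> homog 8" using g hom' by auto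
    show "eval (g - ?g') u = 0" if "L x u = 0" for x u
      using c[OF that] dir_deriv_f[OF that] by (simp add: g' w del: eval_sum)
  qed simp
  then have "g = ?g'" by (intro poly3_eqI) simp
  then show thesis by (rule that)
qed

end

section \<open>Ideals and modules\<close>

lemma module_poly3: "module ((*) :: poly3 \<Rightarrow> poly3 \<Rightarrow> poly3)"
  by unfold_locales (simp_all add: algebra_simps)

lemma in_jacobian_ideal_iff: "p \<in> jacobian_ideal f \<longleftrightarrow> (\<exists>r. p = (\<Sum>k\<in>UNIV. r k * partial k f))"
proof -
  interpret module "(*) :: poly3 \<Rightarrow> poly3 \<Rightarrow> poly3" by (rule module_poly3)
  let ?T = "range (\<lambda>r. \<Sum>k\<in>UNIV. r k * partial k f)"
  have "subspace ?T"
  proof (rule subspaceI)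
    show "0 \<in> ?T" by (rule range_eqI[of _ _ "\<lambda>_. 0"]) simp
    show "p + q \<in> ?T" if pq: "p \<in> ?T" "q \<in> ?T" for p q
    proof -
      from pq obtain r s where "p = (\<Sum>k\<in>UNIV. r k * partial k f)" "q = (\<Sum>k\<in>UNIV. s k * partial k f)" by auto
      then show ?thesis
        by (intro range_eqI[of _ _ "\<lambda>k. r k + s k"]) (simp add: distrib_right sum.distrib)
    qed
    show "c * p \<in> ?T" if p: "p \<in> ?T" for c p
    proof -
      from p obtain r where "p = (\<Sum>k\<in>UNIV. r k * partial k f)" by auto
      then have "c * p = (\<Sum>k\<in>UNIV. c * r k * partial k f)"
        by (simp only: sum_distrib_left mult.assoc)
      then show ?thesis by (rule range_eqI[where x = "\<lambda>k. c * r k"])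
    qed
  qed
  moreover have "range (\<lambda>i. partial i f) \<subseteq> ?T"
  proof (rule image_subsetI)
    fix i
    have "(\<Sum>k\<in>UNIV. (if k = i then 1 else 0) * partial k f) = (\<Sum>k\<in>UNIV. if k = i then partial k f else 0)"
      by (rule sum.cong) simp_all
    then have "partial i f = (\<Sum>k\<in>UNIV. (if k = i then 1 else 0) * partial k f)" by simp
    then show "partial i f \<in> ?T" by (rule range_eqI[where x = "\<lambda>k. if k = i then 1 else 0"])
  qed
  ultimately have "jacobian_ideal f \<subseteq> ?T"
    unfolding jacobian_ideal_def ideal_gen_def by (intro span_minimal)
  moreover have "?T \<subseteq> jacobian_ideal f"
    unfolding jacobian_ideal_def ideal_gen_def
    by (intro image_subsetI span_sum span_scale span_base rangeI)
  ultimately show ?thesis by blast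
qed

lemma linform_power_in_ideal_power: "linform e ^ n \<in> ideal_power max_ideal n"
proof (induction n)
  case (Suc n)
  interpret module "(*) :: poly3 \<Rightarrow> poly3 \<Rightarrow> poly3" by (rule module_poly3)
  have "linform e \<in> max_ideal"
    unfolding linform_def max_ideal_def ideal_gen_def by (intro span_sum span_scale span_base) auto
  with Suc show ?case
    unfolding ideal_power.simps ideal_gen_def power_Suc by (intro span_base) auto
qed simp

lemma jacobian_le_saturated: "jacobian_ideal f \<subseteq> saturated_jacobian_ideal f"
proof -
  interpret module "(*) :: poly3 \<Rightarrow> poly3 \<Rightarrow> poly3" by (rule module_poly3)
  show ?thesis
    unfolding saturated_jacobian_ideal_def saturation_def jacobian_ideal_def ideal_gen_def
    by (auto intro!: exI[of _ 0] intro: span_scale)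
qed

lemma lookup_map_mult [simp]:
  "Poly_Mapping.lookup (Poly_Mapping.map ((*) a) p) k = (a :: complex) * Poly_Mapping.lookup p k"
  by (simp add: Poly_Mapping.map.rep_eq when_def)

lemma module_poly_mapping:
  "module (\<lambda>a. Poly_Mapping.map ((*) a) :: (nat \<Rightarrow>\<^sub>0 complex) \<Rightarrow> (nat \<Rightarrow>\<^sub>0 complex))"
  by unfold_locales
    (auto intro!: poly_mapping_eqI simp: lookup_add algebra_simps)

section \<open>Points and zero sets\<close>

lemma coords_nonzero: "coords X \<noteq> 0" and point_coords: "point (coords X) = X"
  using Quotient3_rep_reflp[OF Quotient3_proj_plane, of X] Quotient3_abs_rep[OF Quotient3_proj_plane, of X]
  by (auto simp: proportional_def)

lemma point_eqD:
  assumes "point u = point v" "u \<noteq> 0" "v \<noteq> 0"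
  obtains c where "c \<noteq> 0" "v = c *s u"
proof -
  have "proportional u u" "proportional v v"
    using assms(2,3) by (auto simp: proportional_def vec_eq_iff intro!: exI[of _ 1])
  then have "proportional u v"
    using Quotient3_rel[OF Quotient3_proj_plane, of u v] assms(1) by simp
  then show thesis using that unfolding proportional_def by blast
qed

lemma point_in_zero_set_iff:
  assumes "p \<in> homog k" "v \<noteq> 0"
  shows "point v \<in> zero_set p \<longleftrightarrow> eval p v = 0"
proof
  assume "eval p v = 0"
  show "point v \<in> zero_set p"
    unfolding zero_set_def
  proof (intro CollectI allI impI)
    fix w assume "w \<noteq> 0 \<and> point w = point v"
    then obtain c where "w = c *s v" using point_eqD[of v w] assms(2) by metis
    then show "eval p w = 0" using \<open>eval p v = 0\<close> by (simp add: eval_scale[OF assms(1)])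
  qed
qed (use assms in \<open>auto simp: zero_set_def\<close>)

lemma in_zero_set_iff: "p \<in> homog k \<Longrightarrow> X \<in> zero_set p \<longleftrightarrow> eval p (coords X) = 0"
  using point_in_zero_set_iff[of p k "coords X"] by (simp add: coords_nonzero point_coords)

lemma zero_set_linform_scale: "c \<noteq> 0 \<Longrightarrow> zero_set (linform (c *s n)) = zero_set (linform n)"
  by (simp add: zero_set_def)

lemma equation_of_joinD:
  assumes "equation_of_join m X Y"
  shows "ccross (coords X) (coords Y) \<noteq> 0"
    and "\<exists>k. k \<noteq> 0 \<and> m = linform (k *s ccross (coords X) (coords Y))"
proof -
  have m: "X \<noteq> Y" "m \<in> homog 1" "m \<noteq> 0" "X \<in> zero_set m" "Y \<in> zero_set m"
    using assms by (auto simp: equation_of_join_def)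
  show indep: "ccross (coords X) (coords Y) \<noteq> 0"
  proof
    assume "ccross (coords X) (coords Y) = 0"
    then obtain c where c: "coords Y = c *s coords X" using ccross_eq_0D coords_nonzero by blast
    then have "c \<noteq> 0" using coords_nonzero[of Y] by auto
    with c have "proportional (coords X) (coords Y)"
      using coords_nonzero by (auto simp: proportional_def)
    then have "point (coords X) = point (coords Y)"
      using Quotient3_rel[OF Quotient3_proj_plane] by blast
    with m(1) show False by (simp add: point_coords)
  qed
  obtain n where n: "m = linform n" using homog_1_eq_linform[OF m(2)] .
  have "cdot n (coords X) = 0" "cdot n (coords Y) = 0"
    using m(2,4,5) in_zero_set_iff by (auto simp: n)
  then obtain k where k: "n = k *s ccross (coords X) (coords Y)" using normal_of_plane[OF indep] by blast
  have "k \<noteq> 0"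
  proof
    assume "k = 0"
    then have "m = 0" by (intro poly3_eqI) (simp add: n k)
    with m(3) show False ..
  qed
  with n k show "\<exists>k. k \<noteq> 0 \<and> m = linform (k *s ccross (coords X) (coords Y))" by blast
qed

section \<open>From the hexagon to the bipartite graph\<close>

text \<open>
  The order in which the edges appear in \<open>hexagon_forms\<close>: the sides \<open>A\<^sub>1A\<^sub>2, \<dots>, A\<^sub>6A\<^sub>1\<close>, then the
  diagonals \<open>A\<^sub>1A\<^sub>4, A\<^sub>2A\<^sub>5, A\<^sub>3A\<^sub>6\<close>.
\<close>
definition edges :: "(3 \<times> 3) list" where
  "edges = [(1, 1), (2, 1), (2, 2), (3, 2), (3, 3), (1, 3), (1, 2), (3, 1), (2, 3)]"

lemma distinct_edges: "distinct edges" and set_edges: "set edges = UNIV" and length_edges: "length edges = 9"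
proof -
  show "distinct edges" "length edges = 9" by (simp_all add: edges_def)
  then have "card (set edges) = CARD(3 \<times> 3)" by (simp add: distinct_card)
  then show "set edges = UNIV" by (intro card_subset_eq) auto
qed

lemma bij_edges: "bij_betw (\<lambda>k. edges ! k) {..<9} UNIV"
  using bij_betw_nth[OF distinct_edges, of "{..<9}" UNIV] by (simp add: length_edges set_edges)

lemma sum_edges: "(\<Sum>k<9. F (edges ! k)) = (\<Sum>x\<in>UNIV. F x)"
  by (rule sum.reindex_bij_betw[OF bij_edges])

text \<open>
  Coinciding lines and concurrent perfect matchings are excluded by counting: nine forms have
  nine different zero sets, and a common point of three lines is a triple point, hence a vertex,
  whereas a vertex lies on just one line of a perfect matching.
\<close>
lemma hexagon_bipartite:
  fixes A :: "nat \<Rightarrow> proj_plane" and l l' :: "nat \<Rightarrow> poly3"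
  assumes hexagon: "hexagon_equations A l l'"
    and forms: "ms = hexagon_forms l l'"
    and not_on_conic: "\<not> (\<exists>C. is_conic C \<and> A ` {1..6} \<subseteq> C)"
    and distinct_lines: "card (lines ms) = 9"
    and points: "multiple_points (lines ms) \<subseteq> double_points (lines ms) \<union> triple_points (lines ms)"
    and triple: "triple_points (lines ms) = A ` {1..6}"
  obtains P Q K where "bipartite_hexagon P Q K"
    "ms = map (\<lambda>x. linform (bipartite_hexagon.normal P Q K x)) edges"
proof -
  define P where "P i = coords (if i = 1 then A 1 else if i = 2 then A 3 else A 5)" for i :: 3
  define Q where "Q j = coords (if j = 1 then A 2 else if j = 2 then A 4 else A 6)" for j :: 3
  have P: "P 1 = coords (A 1)" "P 2 = coords (A 3)" "P 3 = coords (A 5)"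
    and Q: "Q 1 = coords (A 2)" "Q 2 = coords (A 4)" "Q 3 = coords (A 6)"
    by (simp_all add: P_def Q_def)
  define M where "M x = (if x = (1, 1) then l 1 else if x = (2, 1) then l 2 else if x = (2, 2) then l 3
    else if x = (3, 2) then l 4 else if x = (3, 3) then l 5 else if x = (1, 3) then l 6
    else if x = (1, 2) then l' 1 else if x = (3, 1) then l' 2 else l' 3)" for x :: "3 \<times> 3"
  have ms: "ms = map M edges"
    by (simp add: forms hexagon_forms_def edges_def M_def upt_rec numeral_eq_Suc)
  have A7: "A 7 = A 1" and sides: "\<And>j. j \<in> {1..6} \<Longrightarrow> equation_of_join (l j) (A j) (A (j + 1))"
    and diags: "\<And>k. k \<in> {1..3} \<Longrightarrow> equation_of_join (l' k) (A k) (A (k + 3))"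
    using hexagon by (auto simp: hexagon_equations_def)
  have sym: "equation_of_join m Y X" if "equation_of_join m X Y" for m X Y
    using that by (auto simp: equation_of_join_def)
  have join: "\<exists>X Y. equation_of_join (M (i, j)) X Y \<and> coords X = P i \<and> coords Y = Q j" for i j
  proof -
    have "equation_of_join (l 1) (A 1) (A 2)" "equation_of_join (l 2) (A 3) (A 2)" "equation_of_join (l 3) (A 3) (A 4)"
      "equation_of_join (l 4) (A 5) (A 4)" "equation_of_join (l 5) (A 5) (A 6)" "equation_of_join (l 6) (A 1) (A 6)"
      "equation_of_join (l' 1) (A 1) (A 4)" "equation_of_join (l' 2) (A 5) (A 2)" "equation_of_join (l' 3) (A 3) (A 6)"
      using sides[of 1, unfolded one_add_one] sides[of 2] sides[of 3] sides[of 4] sides[of 5] sides[of 6] diags[of 1] diags[of 2] diags[of 3] A7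
      by (auto intro: sym)
    then have "\<forall>i j. \<exists>X Y. equation_of_join (M (i, j)) X Y \<and> coords X = P i \<and> coords Y = Q j"
      unfolding forall_3 P Q by (auto simp: M_def)
    then show ?thesis by blast
  qed
  have PQ: "ccross (P i) (Q j) \<noteq> 0" for i j using join[of i j] equation_of_joinD(1) by metis
  have "\<forall>x. \<exists>k. k \<noteq> 0 \<and> M x = linform (k *s ccross (P (fst x)) (Q (snd x)))"
    using join equation_of_joinD(2) by (metis prod.collapse)
  from choice[OF this] obtain k where k: "\<And>x. k x \<noteq> 0" "\<And>x. M x = linform (k x *s ccross (P (fst x)) (Q (snd x)))"
    by blast
  define K where "K i j = k (i, j)" for i j
  define n where "n x = k x *s ccross (P (fst x)) (Q (snd x))" for x
  have n0: "n x \<noteq> 0" for x using k(1) PQ by (simp add: n_def)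
  have M: "M x = linform (n x)" for x by (simp add: k(2) n_def)
  have "distinct (map (\<lambda>x. zero_set (M x)) edges)"
    using distinct_lines by (intro card_distinct) (simp add: lines_def ms length_edges image_image)
  then have inj: "inj (\<lambda>x. zero_set (M x))" by (simp add: distinct_map set_edges)
  have not_parallel: "ccross (n x) (n y) \<noteq> 0" if "x \<noteq> y" for x y
  proof
    assume "ccross (n x) (n y) = 0"
    then obtain c where c: "n y = c *s n x" using ccross_eq_0D n0 by blast
    then have "c \<noteq> 0" using n0[of y] by auto
    then have "zero_set (M y) = zero_set (M x)" by (simp add: M c zero_set_linform_scale)
    with inj that show False by (auto dest: injD)
  qed
  have PPQ: "bracket (P a) (P b) (Q j) \<noteq> 0" if "a \<noteq> b" for a b j
  proof -
    have "ccross (n (a, j)) (n (b, j)) = (k (a, j) * k (b, j) * bracket (P a) (P b) (Q j)) *s Q j"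
      by (simp add: n_def ccross_scale_left ccross_scale_right ccross_of_ccross_same_right mult_ac)
    with not_parallel[of "(a, j)" "(b, j)"] that show ?thesis by auto
  qed
  have QQP: "bracket (Q a) (Q b) (P i) \<noteq> 0" if "a \<noteq> b" for a b i
  proof -
    have "ccross (n (i, a)) (n (i, b)) = (k (i, a) * k (i, b) * bracket (Q a) (Q b) (P i)) *s P i"
      by (simp add: n_def ccross_scale_left ccross_scale_right ccross_of_ccross_same_left mult_ac)
    with not_parallel[of "(i, a)" "(i, b)"] that show ?thesis by auto
  qed
  have A_vertex: "(\<exists>i. coords X = P i) \<or> (\<exists>j. coords X = Q j)" if "X \<in> A ` {1..6}" for X
  proof -
    have "{1..6 :: nat} = {1, 2, 3, 4, 5, 6}" by auto
    with that have "X \<in> {A 1, A 2, A 3, A 4, A 5, A 6}" by auto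
    then show ?thesis using P Q by (metis insertE emptyE)
  qed
  have hex: "bipartite_hexagon P Q K"
  proof
    show "bracket (P a) (P b) (Q j) \<noteq> 0" if "a \<noteq> b" for a b j using PPQ that .
    show "bracket (Q a) (Q b) (P i) \<noteq> 0" if "a \<noteq> b" for a b i using QQP that .
    show "K i j \<noteq> 0" for i j by (simp add: K_def k(1))
    show "bracket (P c) (Q m) v \<noteq> 0"
      if d: "distinct [a, b, c]" "distinct [i, j, m]" and v: "v \<noteq> 0"
        and on: "bracket (P a) (Q i) v = 0" "bracket (P b) (Q j) v = 0" for a b c i j m v
    proof
      assume on3: "bracket (P c) (Q m) v = 0"
      let ?Z = "\<lambda>x. zero_set (M x)"
      have in_Z: "point v \<in> ?Z (e, g) \<longleftrightarrow> bracket (P e) (Q g) v = 0" for e g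
        using point_in_zero_set_iff[OF homog_linform v, of "n (e, g)"] k(1) by (simp add: M n_def bracket_def)
      have sub: "?Z ` {(a, i), (b, j), (c, m)} \<subseteq> {L \<in> lines ms. point v \<in> L}"
        using on on3 set_edges by (auto simp: lines_def ms in_Z)
      have card3: "card (?Z ` {(a, i), (b, j), (c, m)}) = 3"
        using d by (subst card_image[OF inj_on_subset[OF inj]]) auto
      have "finite {L \<in> lines ms. point v \<in> L}" by (simp add: lines_def)
      from card_mono[OF this sub] card3 have three: "multiplicity_at (lines ms) (point v) \<ge> 3"
        unfolding multiplicity_at_def by linarith
      then have "point v \<in> multiple_points (lines ms)" by (simp add: multiple_points_def)
      with points three have "point v \<in> triple_points (lines ms)" by (auto simp: double_points_def)
      then have "point v \<in> A ` {1..6}" using triple by simp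
      then consider e where "coords (point v) = P e" | e where "coords (point v) = Q e" using A_vertex by blast
      moreover obtain h where h: "h \<noteq> 0" "coords (point v) = h *s v"
        using point_eqD[of v "coords (point v)"] v coords_nonzero point_coords by metis
      have vanish: "bracket (P e) (Q g) (coords (point v)) = 0" if "bracket (P e) (Q g) v = 0" for e g
        using that by (simp add: h bracket_def)
      ultimately show False
      proof cases
        case (1 e)
        have off: "bracket (P g) (Q h) (P e) \<noteq> 0" if "g \<noteq> e" for g h
          using PPQ[OF that, of h] bracket_swap23[of "P g" "Q h" "P e"] by simp
        show False using vanish[OF on(1)] vanish[OF on(2)] off[of a i] off[of b j] d 1 by auto
      next
        case (2 e)
        have off: "bracket (P h) (Q g) (Q e) \<noteq> 0" if "g \<noteq> e" for g h
          using QQP[OF that, of h] bracket_rotate[of "Q g" "Q e" "P h"] by simp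
        show False using vanish[OF on(1)] vanish[OF on(2)] off[of i a] off[of j b] d 2 by auto
      qed
    qed
    show "bracket (P 3) (Q 2) (P 1) * bracket (Q 3) (Q 1) (P 1) * bracket (P 3) (Q 1) (P 2) * bracket (Q 3) (Q 2) (P 2)
       \<noteq> bracket (P 3) (Q 1) (P 1) * bracket (Q 3) (Q 2) (P 1) * bracket (P 3) (Q 2) (P 2) * bracket (Q 3) (Q 1) (P 2)"
    proof
      assume eq: "bracket (P 3) (Q 2) (P 1) * bracket (Q 3) (Q 1) (P 1) * bracket (P 3) (Q 1) (P 2) * bracket (Q 3) (Q 2) (P 2)
       = bracket (P 3) (Q 1) (P 1) * bracket (Q 3) (Q 2) (P 1) * bracket (P 3) (Q 2) (P 2) * bracket (Q 3) (Q 1) (P 2)"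
      have nz: "bracket (P 3) (Q 2) (P 1) \<noteq> 0" "bracket (Q 3) (Q 1) (P 1) \<noteq> 0"
         "bracket (P 3) (Q 1) (Q 2) \<noteq> 0" "bracket (Q 3) (Q 2) (P 3) \<noteq> 0"
        using PPQ[of 3 1 2] QQP[of 3 1 1] QQP[of 1 2 3] QQP[of 3 2 3]
          bracket_swap23[of "P 3" "Q 2" "P 1"] bracket_rotate[of "Q 1" "Q 2" "P 3"] by auto
      obtain q where q: "q \<in> homog 2" "q \<noteq> 0" "\<And>v. v \<in> {P 1, P 2, P 3, Q 1, Q 2, Q 3} \<Longrightarrow> eval q v = 0"
        using conic_through_six[OF eq nz] by blast
      have "A ` {1..6} \<subseteq> zero_set q"
      proof
        fix X assume "X \<in> A ` {1..6}"
        moreover have "\<forall>i. P i \<in> {P 1, P 2, P 3, Q 1, Q 2, Q 3}" "\<forall>j. Q j \<in> {P 1, P 2, P 3, Q 1, Q 2, Q 3}"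
          by (simp_all add: forall_3)
        ultimately have "coords X \<in> {P 1, P 2, P 3, Q 1, Q 2, Q 3}"
          using A_vertex[of X] by fastforce
        then show "X \<in> zero_set q" using q(3) in_zero_set_iff[OF q(1)] by blast
      qed
      moreover have "is_conic (zero_set q)" using q by (auto simp: is_conic_def)
      ultimately show False using not_on_conic by blast
    qed
  qed
  have "bipartite_hexagon.normal P Q K x = n x" for x
    by (simp add: bipartite_hexagon.normal_def[OF hex] n_def K_def)
  then have "ms = map (\<lambda>x. linform (bipartite_hexagon.normal P Q K x)) edges"
    by (simp add: ms M)
  with hex show thesis by (rule that)
qed

section \<open>2-formality\<close>

text \<open>
  The vector in \<open>\<complex>\<^sup>9\<close> whose coordinates are the values of \<open>r\<close> on the edges.
\<close>
definition on_edges :: "(3 \<times> 3 \<Rightarrow> complex) \<Rightarrow> nat \<Rightarrow>\<^sub>0 complex" where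
  "on_edges r = (\<Sum>k<9. Poly_Mapping.single k (r (edges ! k)))"

lemma lookup_on_edges: "Poly_Mapping.lookup (on_edges r) k = (if k < 9 then r (edges ! k) else 0)"
proof -
  have "Poly_Mapping.lookup (on_edges r) k = (\<Sum>j<9. if j = k then r (edges ! k) else 0)"
    unfolding on_edges_def lookup_sum by (intro sum.cong) (auto simp: lookup_single)
  then show ?thesis by simp
qed

lemma keys_on_edges: "Poly_Mapping.keys (on_edges r) = {k. k < 9 \<and> r (edges ! k) \<noteq> 0}"
  by (auto simp: in_keys_iff lookup_on_edges split: if_splits)

lemma card_keys_on_edges: "card (Poly_Mapping.keys (on_edges r)) = card {x. r x \<noteq> 0}"
proof -
  have "bij_betw (\<lambda>k. edges ! k) {k \<in> {..<9}. r (edges ! k) \<noteq> 0} {x \<in> UNIV. r x \<noteq> 0}"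
    using bij_edges by (auto simp: bij_betw_def inj_on_def image_iff) (metis lessThan_iff rangeE UNIV_I imageE)
  from bij_betw_same_card[OF this] show ?thesis by (simp add: keys_on_edges)
qed

lemma relation_eq_on_edges:
  assumes "Poly_Mapping.keys c \<subseteq> {..<9}"
  obtains r where "c = on_edges r"
proof -
  define r where "r x = Poly_Mapping.lookup c (inv_into {..<9} (\<lambda>k. edges ! k) x)" for x
  have "c = on_edges r"
  proof (rule poly_mapping_eqI)
    fix k
    show "Poly_Mapping.lookup c k = Poly_Mapping.lookup (on_edges r) k"
    proof (cases "k < 9")
      case True
      then show ?thesis
        using bij_betw_inv_into_left[OF bij_edges, of k] by (simp add: lookup_on_edges r_def)
    next
      case False
      then show ?thesis using assms by (auto simp: lookup_on_edges in_keys_iff)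
    qed
  qed
  then show thesis by (rule that)
qed

context bipartite_hexagon
begin

lemma on_edges_relation_iff:
  "on_edges r \<in> relation_space (map (\<lambda>x. linform (normal x)) edges) \<longleftrightarrow> (\<Sum>x\<in>UNIV. r x *s normal x) = 0"
proof -
  have "(\<Sum>j<9. const (Poly_Mapping.lookup (on_edges r) j) * linform (normal (edges ! j)))
     = (\<Sum>x\<in>UNIV. const (r x) * linform (normal x))"
    by (subst sum_edges[symmetric]) (simp add: lookup_on_edges)
  also have "\<dots> = linform (\<Sum>x\<in>UNIV. r x *s normal x)"
    by (rule poly3_eqI)
      (simp add: eval_sum cdot_def sum_distrib_left sum_distrib_right sum.distrib algebra_simps)
  finally have eq: "(\<Sum>j<9. const (Poly_Mapping.lookup (on_edges r) j) * linform (normal (edges ! j)))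
    = linform (\<Sum>x\<in>UNIV. r x *s normal x)" .
  have "linform n = 0 \<longleftrightarrow> n = 0" for n
  proof
    assume "linform n = 0"
    then have "cdot n v = 0" for v using eval_linform[of n v] by simp
    then show "n = 0" using exists_cdot_eq_1[of n] by (metis zero_neq_one)
  qed (simp add: linform_def const_def)
  then show ?thesis
    using eq by (auto simp: relation_space_def length_edges keys_on_edges)
qed

text \<open>
  The relations at the six vertices have exactly three nonzero coordinates, because the
  coefficients of the lines through the vertex are all nonzero, and they span by
  \<open>relations_spanned_by_vertices\<close>.
\<close>
lemma two_formal_edges: "two_formal (map (\<lambda>x. linform (normal x)) edges)"
proof -
  interpret M: module "\<lambda>a. Poly_Mapping.map ((*) a) :: (nat \<Rightarrow>\<^sub>0 complex) \<Rightarrow> (nat \<Rightarrow>\<^sub>0 complex)"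
    by (rule module_poly_mapping)
  let ?R = "relation_space (map (\<lambda>x. linform (normal x)) edges)"
  let ?T = "{c \<in> ?R. card (Poly_Mapping.keys c) = 3}"
  have add: "on_edges r + on_edges s = on_edges (\<lambda>x. r x + s x)" for r s
    by (rule poly_mapping_eqI) (simp add: lookup_add lookup_on_edges)
  have scale: "Poly_Mapping.map ((*) a) (on_edges r) = on_edges (\<lambda>x. a * r x)" for a r
    by (rule poly_mapping_eqI) (simp add: lookup_on_edges)
  have R: "\<exists>r. c = on_edges r" if "c \<in> ?R" for c
    using relation_eq_on_edges[of c] that by (auto simp: relation_space_def length_edges)
  have "M.subspace ?R"
  proof (rule M.subspaceI)
    show "0 \<in> ?R" by (simp add: relation_space_def const_def)
    show "c + d \<in> ?R" if cd: "c \<in> ?R" "d \<in> ?R" for c d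
    proof -
      obtain r s where rs: "c = on_edges r" "d = on_edges s" using R[OF cd(1)] R[OF cd(2)] by blast
      with cd have "(\<Sum>x\<in>UNIV. r x *s normal x) = 0" "(\<Sum>x\<in>UNIV. s x *s normal x) = 0"
        by (simp_all only: on_edges_relation_iff)
      then have "(\<Sum>x\<in>UNIV. (r x + s x) *s normal x) = 0"
        by (simp add: vector_sadd_rdistrib sum.distrib)
      then show ?thesis by (simp only: rs add on_edges_relation_iff)
    qed
    show "Poly_Mapping.map ((*) a) c \<in> ?R" if c: "c \<in> ?R" for a c
    proof -
      obtain r where r: "c = on_edges r" using R[OF c] by blast
      with c have "(\<Sum>x\<in>UNIV. r x *s normal x) = 0" by (simp only: on_edges_relation_iff)
      then have "a *s (\<Sum>x\<in>UNIV. r x *s normal x) = 0" by simp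
      moreover have "a *s (\<Sum>x\<in>UNIV. r x *s normal x) = (\<Sum>x\<in>UNIV. (a * r x) *s normal x)"
        by (simp add: vec_eq_iff sum_distrib_left mult.assoc)
      ultimately show ?thesis by (simp only: r scale on_edges_relation_iff)
    qed
  qed
  then have "M.span ?T \<subseteq> ?R" by (intro M.span_minimal) auto
  moreover have "?R \<subseteq> M.span ?T"
  proof
    fix c assume c: "c \<in> ?R"
    obtain r where r: "c = on_edges r" using R[OF c] by blast
    with c have "(\<Sum>x\<in>UNIV. r x *s normal x) = 0" by (simp only: on_edges_relation_iff)
    then obtain s t where st: "\<And>i j. r (i, j) = s i * relP i j + t j * relQ j i"
      using relations_spanned_by_vertices by metis
    define rP where "rP i x = (if fst x = i then relP i (snd x) else 0)" for i x
    define rQ where "rQ j x = (if snd x = j then relQ j (fst x) else 0)" for j x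
    have "(\<Sum>x\<in>UNIV. rP i x *s normal x) = (\<Sum>k\<in>UNIV. if k = i then \<Sum>j\<in>UNIV. relP i j *s normal (i, j) else 0)" for i
      unfolding sum_lines by (intro sum.cong) (auto simp: rP_def)
    then have P_rel: "(\<Sum>x\<in>UNIV. rP i x *s normal x) = 0" for i by (simp add: relP_relation)
    have "(\<Sum>x\<in>UNIV. rQ j x *s normal x) = (\<Sum>k\<in>UNIV. if k = j then \<Sum>i\<in>UNIV. relQ j i *s normal (i, j) else 0)" for j
      unfolding sum_lines by (subst sum.swap, intro sum.cong) (auto simp: rQ_def)
    then have Q_rel: "(\<Sum>x\<in>UNIV. rQ j x *s normal x) = 0" for j by (simp add: relQ_relation)
    have "{x. rP i x \<noteq> 0} = {i} \<times> UNIV" "{x. rQ j x \<noteq> 0} = UNIV \<times> {j}" for i j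
      using relP_nonzero relQ_nonzero by (auto simp: rP_def rQ_def)
    then have "card {x. rP i x \<noteq> 0} = 3" "card {x. rQ j x \<noteq> 0} = 3" for i j
      by (simp_all add: card_cartesian_product)
    then have T: "on_edges (rP i) \<in> ?T" "on_edges (rQ j) \<in> ?T" for i j
      using P_rel Q_rel by (simp_all only: mem_Collect_eq on_edges_relation_iff card_keys_on_edges simp_thms)
    have "c = (\<Sum>i\<in>UNIV. Poly_Mapping.map ((*) (s i)) (on_edges (rP i)))
        + (\<Sum>j\<in>UNIV. Poly_Mapping.map ((*) (t j)) (on_edges (rQ j)))"
    proof (rule poly_mapping_eqI)
      fix k
      obtain i j where e: "edges ! k = (i, j)" by fastforce
      have "(\<Sum>i'\<in>UNIV. s i' * rP i' (i, j)) = s i * relP i j" "(\<Sum>j'\<in>UNIV. t j' * rQ j' (i, j)) = t j * relQ j i"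
        by (simp_all add: rP_def rQ_def if_distrib[of "\<lambda>x. y * x" for y] cong: if_cong)
      then show "Poly_Mapping.lookup c k = Poly_Mapping.lookup ((\<Sum>i\<in>UNIV. Poly_Mapping.map ((*) (s i)) (on_edges (rP i)))
        + (\<Sum>j\<in>UNIV. Poly_Mapping.map ((*) (t j)) (on_edges (rQ j)))) k"
        by (simp add: r lookup_add lookup_sum lookup_on_edges e st)
    qed
    also have "\<dots> \<in> M.span ?T"
      by (intro M.span_add M.span_sum M.span_scale M.span_base T)
    finally show "c \<in> M.span ?T" .
  qed
  ultimately show ?thesis unfolding two_formal_def by blast
qed

section \<open>The three claims\<close>

lemma mdr_f: "mdr f = 6"
  unfolding mdr_def
proof (rule Least_equality)
  obtain r j where r: "(\<Sum>k\<in>UNIV. r k * partial k f) = 0" "\<And>k. r k \<in> homog 6" "r j \<noteq> 0"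
    by (rule syzygy_of_degree_6) blast
  let ?r = "\<chi> k. r k"
  have "?r $ j \<noteq> 0 $ j" using r(3) by simp
  then have "?r \<noteq> 0" by metis
  moreover have "?r \<in> jacobian_syzygies f" using r(1) by (simp add: jacobian_syzygies_def)
  moreover have "\<forall>i. ?r $ i \<in> homog 6" using r(2) by simp
  ultimately show "\<exists>r\<in>jacobian_syzygies f. r \<noteq> 0 \<and> (\<forall>i. r $ i \<in> homog 6)" by blast
next
  fix d assume "\<exists>r\<in>jacobian_syzygies f. r \<noteq> 0 \<and> (\<forall>i. r $ i \<in> homog d)"
  then obtain r where r: "(\<Sum>k\<in>UNIV. r $ k * partial k f) = 0" "r \<noteq> 0" "\<And>i. r $ i \<in> homog d"
    by (auto simp: jacobian_syzygies_def)
  show "6 \<le> d"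
  proof (rule ccontr)
    assume "\<not> 6 \<le> d"
    then have "r $ k = 0" for k using no_syzygy_below_6[of "\<lambda>k. r $ k", OF r(1) r(3)] by simp
    then show False using r(2) by (simp add: vec_eq_iff)
  qed
qed

lemma saturation_degree_8: "saturated_jacobian_ideal f \<inter> homog 8 = jacobian_ideal f \<inter> homog 8"
proof
  show "saturated_jacobian_ideal f \<inter> homog 8 \<subseteq> jacobian_ideal f \<inter> homog 8"
  proof
    fix g assume "g \<in> saturated_jacobian_ideal f \<inter> homog 8"
    then obtain n where g: "g \<in> homog 8" "\<And>q. q \<in> ideal_power max_ideal n \<Longrightarrow> q * g \<in> jacobian_ideal f"
      by (auto simp: saturated_jacobian_ideal_def saturation_def)
    then have "\<exists>r. linform e ^ n * g = (\<Sum>k\<in>UNIV. r k * partial k f)" for e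
      using linform_power_in_ideal_power in_jacobian_ideal_iff by blast
    then obtain w where "g = (\<Sum>k\<in>UNIV. const (w $ k) * partial k f)"
      using saturated_degree_8[OF g(1)] by blast
    then have "g \<in> jacobian_ideal f" unfolding in_jacobian_ideal_iff by (rule exI[where x = "\<lambda>k. const (w $ k)"])
    with g(1) show "g \<in> jacobian_ideal f \<inter> homog 8" by simp
  qed
qed (use jacobian_le_saturated in blast)

lemma f_eq_prod_list: "f = prod_list (map (\<lambda>x. linform (normal x)) edges)"
  using prod.distinct_set_conv_list[OF distinct_edges, of "\<lambda>x. linform (normal x)"]
  by (simp add: f_def set_edges)

end

theorem theorem1p8:
  fixes A :: "nat \<Rightarrow> proj_plane" and l l' :: "nat \<Rightarrow> poly3"
    and ms :: "poly3 list" and f :: poly3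
  assumes hexagon: "hexagon_equations A l l'"
    and forms: "ms = hexagon_forms l l'"
    and f: "f = prod_list ms"
    and not_on_conic: "\<not> (\<exists>C. is_conic C \<and> A ` {1..6} \<subseteq> C)"
    and distinct_lines: "card (lines ms) = 9"
    and points: "multiple_points (lines ms) \<subseteq> double_points (lines ms) \<union> triple_points (lines ms)"
    and triple: "triple_points (lines ms) = A ` {1..6}"
    and six_triple: "card (triple_points (lines ms)) = 6"
  shows "saturated_jacobian_ideal f \<inter> homog 8 = jacobian_ideal f \<inter> homog 8
    \<and> mdr f = 6 \<and> two_formal ms"
proof -
  obtain P Q K where hex: "bipartite_hexagon P Q K"
    and ms: "ms = map (\<lambda>x. linform (bipartite_hexagon.normal P Q K x)) edges"
    using hexagon_bipartite[OF hexagon forms not_on_conic distinct_lines points triple] .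
  interpret bipartite_hexagon P Q K by (rule hex)
  have "f = bipartite_hexagon.f P Q K"
    by (simp add: f ms f_eq_prod_list)
  then show ?thesis
    using saturation_degree_8 mdr_f two_formal_edges by (simp add: ms)
qed

end
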